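(* Fix $1\leqslant p\leqslant\infty$. For any Banach space $X$, any closed subspace $Y$, and $1\leqslant K<C$, (i) $I_p(X,K)\leqslant I_p(X/Y)\,I_p(Y,C)$; (ii) $I_1(X,K)\leqslant I_1(X/Y,3K)\,I_1(Y,3K)$; (iii) $\mathcal{SM}_p(X,K)\leqslant\mathcal{SM}_p(X/Y)+\mathcal{SM}_p(Y,C)$; (iv) $\mathcal{SM}_1(X,K)\leqslant\mathcal{SM}_1(X/Y,3K)+\mathcal{SM}_1(Y,3K)$; (v) $\mathcal{SM}_\infty(X)\leqslant\max\{\mathcal{SM}_\infty(X/Y),\mathcal{SM}_\infty(Y)\}$.
   Context: Trees: a tree is a set of finite sequences (including $\varnothing$) closed under initial segments. $T'$ is $T$ with its maximal members removed, $d^0(T)=T$, $d^{\xi+1}(T)=(d^\xi(T))'$, $d^\xi(T)=\bigcap_{\zeta<\xi}d^\zeta(T)$ for limit $\xi$, $o(T)=\min\{\xi:d^\xi(T)=\varnothing\}$, with $o(T)=\infty$ if no such ordinal exists. Conventions: $\xi<\infty$ for all ordinals $\xi$, and sums and products involving $\infty$ equal $\infty$. Sums and products of ordinals are the usual ordinal operations. $T_p(X,K)$ is the tree of all finite sequences $(x_i)_{i=1}^n$ in the unit ball $B_X$ with $K^{-1}\leqslant\|\sum_{i=1}^na_ix_i\|\leqslant1$ for all $(a_i)_{i=1}^n$ in the unit sphere of $\ell_p^n$. $I_p(X,K)=o(T_p(X,K))$ and $I_p(X)=\sup_{K\geqslant1}I_p(X,K)$. Schreier families: for families $\mathcal{F},\mathcal{G}$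 of finite subsets of $\mathbb{N}$, $\mathcal{F}[\mathcal{G}]$ consists of $\varnothing$ and all unions $\bigcup_{i=1}^sE_i$ with non-empty $E_i\in\mathcal{G}$, $\max E_i<\min E_{i+1}$, $\{\min E_i\}_{i=1}^s\in\mathcal{F}$. $\mathcal{S}_0=\{E:|E|\leqslant1\}$, $\mathcal{S}=\mathcal{S}_1=\{\varnothing\}\cup\{E:|E|\leqslant\min E\}$, $\mathcal{S}_{\xi+1}=\mathcal{S}[\mathcal{S}_\xi]$; for limit $\xi<\omega_1$, $\mathcal{S}_\xi=\{E:\exists n\leqslant\min E,\ E\in\mathcal{S}_{\xi_n+1}\}$ for a fixed sequence $\xi_n\uparrow\xi$ with $\mathcal{S}_{\xi_n+1}\subset\mathcal{S}_{\xi_{n+1}}$; $\mathcal{S}_{\omega_1}$ is the family of all finite subsets of $\mathbb{N}$. An infinite sequence $(x_n)\subset X$ is a $K$-$\ell_p^\xi$ spreading model ($K$-$c_0^\xi$ spreading model if $p=\infty$) if $(x_n)_{n\in E}\in T_p(X,K)$ for each $E\in\mathcal{S}_\xi$. $\mathcal{SM}_p(X,K)=\min\{\xi\leqslant\omega_1:X\text{ admits no }K\text{-}\ell_p^\xi\text{ spreading model}\}$ (with $c_0$ in place of $\ell_p$ when $p=\infty$), $=\infty$ if there is no such $\xi$; $\mathcal{SM}_p(X)=\sup_{K\geqslant1}\mathcal{SM}_p(X,K)$. *)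

theory Defs
  imports "HOL-Analysis.Analysis" "HOL-Library.Sublist"
begin

section \<open>Ordinals\<close>

text \<open>
  \<open>'a ordinal\<close> is a copy of the initial ordinal \<open>\<kappa>\<^sup>+\<close>, where \<open>\<kappa>\<close> is the cardinality of
  \<open>real \<times> 'a\<close>; its elements are thus the ordinals of cardinality at most \<open>\<kappa>\<close>. It is a proper
  initial segment of all ordinals, but large enough for a Banach space whose points form the type
  \<open>'a\<close>: \<open>\<kappa>\<^sup>+\<close> is a regular cardinal above \<open>\<omega>\<^sub>1\<close>, it is closed under sums, products and suprema of
  continuum many elements, and it exceeds the number of finite sequences in the space, in its
  subspaces and in its quotients, so a transfinite sequence of derived trees which does not reach
  \<open>\<emptyset>\<close> below \<open>\<kappa>\<^sup>+\<close> never does.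
\<close>

abbreviation ordinal_rel :: "(real \<times> 'a) set rel" where
  "ordinal_rel \<equiv> cardSuc (card_of UNIV)"

lemma ordinal_rel_Card_order: "Card_order ordinal_rel"
  by (simp add: cardSuc_Card_order card_of_Card_order)

lemma ordinal_rel_Well_order: "Well_order ordinal_rel"
  using ordinal_rel_Card_order card_order_on_well_order_on by blast

lemma ordinal_rel_infinite: "infinite (Field (ordinal_rel :: (real \<times> 'a) set rel))"
proof -
  have "infinite (UNIV :: (real \<times> 'a) set)"
    by (simp add: finite_prod infinite_UNIV_char_0)
  then show ?thesis
    by (simp only: cardSuc_finite[OF card_of_Card_order] Field_card_of not_False_eq_True)
qed

typedef 'a ordinal = "Field (ordinal_rel :: (real \<times> 'a) set rel)"
  using ordinal_rel_infinite by (metis ex_in_conv finite.emptyI)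

instantiation ordinal :: (type) wellorder
begin

definition less_eq_ordinal :: "'a ordinal \<Rightarrow> 'a ordinal \<Rightarrow> bool" where
  "\<alpha> \<le> \<beta> \<longleftrightarrow> (Rep_ordinal \<alpha>, Rep_ordinal \<beta>) \<in> ordinal_rel"

definition less_ordinal :: "'a ordinal \<Rightarrow> 'a ordinal \<Rightarrow> bool" where
  "(\<alpha> :: 'a ordinal) < \<beta> \<longleftrightarrow> \<alpha> \<le> \<beta> \<and> \<alpha> \<noteq> \<beta>"

instance
proof
  let ?r = "ordinal_rel :: (real \<times> 'a) set rel"
  have wo: "refl_on (Field ?r) ?r" "trans ?r" "antisym ?r" "total_on (Field ?r) ?r" "wf (?r - Id)"
    using ordinal_rel_Well_order
    unfolding well_order_on_def linear_order_on_def partial_order_on_def preorder_on_def by auto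
  fix \<alpha> \<beta> \<gamma> :: "'a ordinal"
  note R = Rep_ordinal[of \<alpha>] Rep_ordinal[of \<beta>]
  show "\<alpha> \<le> \<alpha>"
    using wo(1) R by (auto simp: less_eq_ordinal_def refl_on_def)
  show "\<alpha> \<le> \<beta> \<Longrightarrow> \<beta> \<le> \<gamma> \<Longrightarrow> \<alpha> \<le> \<gamma>"
    using wo(2) by (auto simp: less_eq_ordinal_def dest: transD)
  show anti: "\<alpha> \<le> \<beta> \<Longrightarrow> \<beta> \<le> \<alpha> \<Longrightarrow> \<alpha> = \<beta>" for \<alpha> \<beta> :: "'a ordinal"
    using wo(3) by (auto simp: less_eq_ordinal_def antisym_def Rep_ordinal_inject[symmetric])
  show "(\<alpha> < \<beta>) = (\<alpha> \<le> \<beta> \<and> \<not> \<beta> \<le> \<alpha>)"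
    using anti wo(1) R by (auto simp: less_ordinal_def less_eq_ordinal_def refl_on_def)
  show "\<alpha> \<le> \<beta> \<or> \<beta> \<le> \<alpha>"
    using wo(1,4) R Rep_ordinal_inject[of \<alpha> \<beta>]
    by (auto simp: less_eq_ordinal_def refl_on_def total_on_def)
  have "wf (inv_image (?r - Id) Rep_ordinal)"
    using wo(5) by (rule wf_inv_image)
  moreover have "{(\<alpha>, \<beta>). \<alpha> < \<beta>} \<subseteq> inv_image (?r - Id) Rep_ordinal"
    by (auto simp: inv_image_def less_ordinal_def less_eq_ordinal_def Rep_ordinal_inject)
  ultimately have wf: "wf {(\<alpha>, \<beta> :: 'a ordinal). \<alpha> < \<beta>}"
    by (rule wf_subset)
  fix P :: "'a ordinal \<Rightarrow> bool"
  assume "\<And>\<alpha>. (\<And>\<beta>. \<beta> < \<alpha> \<Longrightarrow> P \<beta>) \<Longrightarrow> P \<alpha>"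
  then show "P \<alpha>"
    using wf_induct_rule[OF wf, of P \<alpha>] by blast
qed

end

instantiation ordinal :: (type) zero
begin
definition zero_ordinal :: "'a ordinal" where "0 = (LEAST \<alpha> :: 'a ordinal. True)"
instance ..
end

definition osucc :: "'a ordinal \<Rightarrow> 'a ordinal" where
  "osucc \<alpha> = (LEAST \<beta>. \<alpha> < \<beta>)"

definition is_limit :: "'a ordinal \<Rightarrow> bool" where
  "is_limit \<xi> \<longleftrightarrow> \<xi> \<noteq> 0 \<and> (\<forall>\<zeta>. \<xi> \<noteq> osucc \<zeta>)"

definition opred :: "'a ordinal \<Rightarrow> 'a ordinal" where
  "opred \<xi> = (THE \<zeta>. \<xi> = osucc \<zeta>)"

definition osup :: "'a ordinal set \<Rightarrow> 'a ordinal" where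
  "osup A = (LEAST \<beta>. \<forall>\<alpha>\<in>A. \<alpha> \<le> \<beta>)"

definition omega1 :: "'a ordinal" where
  "omega1 = (LEAST \<xi>. uncountable {..<\<xi>})"

lemma ordinal_no_max: "\<exists>\<beta>. (\<alpha> :: 'a ordinal) < \<beta>"
proof -
  obtain b where "b \<in> Field ordinal_rel" "b \<noteq> Rep_ordinal \<alpha>" "(Rep_ordinal \<alpha>, b) \<in> ordinal_rel"
    using infinite_Card_order_limit[OF ordinal_rel_Card_order ordinal_rel_infinite Rep_ordinal]
    by metis
  then have "\<alpha> < Abs_ordinal b"
    using Abs_ordinal_inverse[of b] by (auto simp: less_ordinal_def less_eq_ordinal_def)
  then show ?thesis ..
qed

lemma less_osucc: "\<alpha> < osucc \<alpha>"
  unfolding osucc_def using ordinal_no_max by (rule LeastI_ex)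

lemma osucc_le: "\<alpha> < \<beta> \<Longrightarrow> osucc \<alpha> \<le> \<beta>"
  unfolding osucc_def by (rule Least_le)

lemma osucc_inject: "osucc \<alpha> = osucc \<beta> \<longleftrightarrow> \<alpha> = \<beta>"
  by (metis less_osucc osucc_le leD linorder_neqE)

lemma opred_osucc [simp]: "opred (osucc \<alpha>) = \<alpha>"
  by (auto simp: opred_def osucc_inject)

text \<open>Transfinite recursion with a zero, a successor and a limit clause.\<close>

function ord_rec :: "'b \<Rightarrow> ('b \<Rightarrow> 'b) \<Rightarrow> ('b set \<Rightarrow> 'b) \<Rightarrow> 'a ordinal \<Rightarrow> 'b" where
  "ord_rec z s l \<xi> =
     (if \<xi> = 0 then z
      else if is_limit \<xi> then l (ord_rec z s l ` {\<zeta>. \<zeta> < \<xi>})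
      else s (ord_rec z s l (opred \<xi>)))"
  by pat_completeness auto
termination
  by (relation "inv_image {(\<alpha>, \<beta>). \<alpha> < \<beta>} (\<lambda>(z, s, l, \<xi>). \<xi>)")
    (auto simp: is_limit_def less_osucc intro!: wf_inv_image wf)

declare ord_rec.simps [simp del]

lemma ord_rec_0: "ord_rec z s l 0 = z"
  by (simp add: ord_rec.simps)

lemma ord_rec_osucc: "ord_rec z s l (osucc \<zeta>) = s (ord_rec z s l \<zeta>)"
proof -
  have "0 \<le> \<zeta>"
    unfolding zero_ordinal_def by (rule Least_le) simp
  then have "osucc \<zeta> \<noteq> 0"
    using less_osucc[of \<zeta>] by auto
  then show ?thesis
    by (subst ord_rec.simps) (auto simp: is_limit_def)
qed

lemma ord_rec_limit: "is_limit \<xi> \<Longrightarrow> ord_rec z s l \<xi> = l (ord_rec z s l ` {\<zeta>. \<zeta> < \<xi>})"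
  by (subst ord_rec.simps) (simp add: is_limit_def)

instantiation ordinal :: (type) "{plus, times}"
begin

definition plus_ordinal :: "'a ordinal \<Rightarrow> 'a ordinal \<Rightarrow> 'a ordinal" where
  "\<alpha> + \<beta> = ord_rec \<alpha> osucc osup \<beta>"

definition times_ordinal :: "'a ordinal \<Rightarrow> 'a ordinal \<Rightarrow> 'a ordinal" where
  "\<alpha> * \<beta> = ord_rec 0 (\<lambda>\<gamma>. \<gamma> + \<alpha>) osup \<beta>"

instance ..

end


section \<open>Ordinals together with infinity\<close>

datatype 'a ordinal_inf = Ord "'a ordinal" | Infty

instantiation ordinal_inf :: (type) wellorder
begin

definition less_eq_ordinal_inf :: "'a ordinal_inf \<Rightarrow> 'a ordinal_inf \<Rightarrow> bool" where
  "x \<le> y \<longleftrightarrow> (case y of Infty \<Rightarrow> True | Ord \<beta> \<Rightarrow> (case x of Infty \<Rightarrow> False | Ord \<alpha> \<Rightarrow> \<alpha> \<le> \<beta>))"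

definition less_ordinal_inf :: "'a ordinal_inf \<Rightarrow> 'a ordinal_inf \<Rightarrow> bool" where
  "(x :: 'a ordinal_inf) < y \<longleftrightarrow> x \<le> y \<and> \<not> y \<le> x"

instance
proof
  fix x y z :: "'a ordinal_inf"
  show "x \<le> x" "x \<le> y \<Longrightarrow> y \<le> z \<Longrightarrow> x \<le> z" "x \<le> y \<Longrightarrow> y \<le> x \<Longrightarrow> x = y" "x \<le> y \<or> y \<le> x"
    "(x < y) = (x \<le> y \<and> \<not> y \<le> x)"
    by (auto simp: less_eq_ordinal_inf_def less_ordinal_inf_def split: ordinal_inf.splits)
  fix P :: "'a ordinal_inf \<Rightarrow> bool"
  assume step: "\<And>x. (\<And>y. y < x \<Longrightarrow> P y) \<Longrightarrow> P x"
  have less: "y < Ord \<alpha> \<Longrightarrow> \<exists>\<beta>. y = Ord \<beta> \<and> \<beta> < \<alpha>" "y < Infty \<Longrightarrow> \<exists>\<beta>. y = Ord \<beta>" for y \<alpha>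
    by (cases y; auto simp: less_eq_ordinal_inf_def less_ordinal_inf_def)+
  have Ord: "P (Ord \<alpha>)" for \<alpha>
    by (induction \<alpha> rule: less_induct) (metis step less(1))
  show "P x"
    by (cases x) (use Ord step less(2) in metis)+
qed

end

instantiation ordinal_inf :: (type) complete_linorder
begin

definition Sup_ordinal_inf :: "'a ordinal_inf set \<Rightarrow> 'a ordinal_inf" where
  "Sup A = (LEAST u :: 'a ordinal_inf. \<forall>x\<in>A. x \<le> u)"

definition Inf_ordinal_inf :: "'a ordinal_inf set \<Rightarrow> 'a ordinal_inf" where
  "Inf A = (LEAST x :: 'a ordinal_inf. x \<in> A \<or> x = Infty)"

definition sup_ordinal_inf :: "'a ordinal_inf \<Rightarrow> 'a ordinal_inf \<Rightarrow> 'a ordinal_inf" where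
  "sup = (max :: 'a ordinal_inf \<Rightarrow> _)"

definition inf_ordinal_inf :: "'a ordinal_inf \<Rightarrow> 'a ordinal_inf \<Rightarrow> 'a ordinal_inf" where
  "inf = (min :: 'a ordinal_inf \<Rightarrow> _)"

definition top_ordinal_inf :: "'a ordinal_inf" where
  "(top :: 'a ordinal_inf) = Infty"

definition bot_ordinal_inf :: "'a ordinal_inf" where
  "(bot :: 'a ordinal_inf) = Ord 0"

instance
proof
  have le_Infty: "x \<le> Infty" for x :: "'a ordinal_inf"
    by (simp add: less_eq_ordinal_inf_def)
  have zero_le: "(0 :: 'a ordinal) \<le> \<alpha>" for \<alpha>
    unfolding zero_ordinal_def by (rule Least_le) simp
  fix x y z :: "'a ordinal_inf" and A :: "'a ordinal_inf set"
  show "inf x y \<le> x" "inf x y \<le> y" "x \<le> y \<Longrightarrow> x \<le> z \<Longrightarrow> x \<le> inf y z"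
    "x \<le> sup x y" "y \<le> sup x y" "y \<le> x \<Longrightarrow> z \<le> x \<Longrightarrow> sup y z \<le> x"
    by (auto simp: inf_ordinal_inf_def sup_ordinal_inf_def)
  show "x \<in> A \<Longrightarrow> Inf A \<le> x"
    unfolding Inf_ordinal_inf_def by (rule Least_le) simp
  have "Inf A \<in> A \<or> Inf A = Infty"
    unfolding Inf_ordinal_inf_def by (rule LeastI) (rule disjI2, rule refl)
  then show "(\<And>x. x \<in> A \<Longrightarrow> z \<le> x) \<Longrightarrow> z \<le> Inf A"
    using le_Infty by metis
  have "\<forall>x\<in>A. x \<le> Sup A"
    unfolding Sup_ordinal_inf_def by (rule LeastI[of _ Infty]) (simp add: le_Infty)
  then show "x \<in> A \<Longrightarrow> x \<le> Sup A"
    by blast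
  show "(\<And>x. x \<in> A \<Longrightarrow> x \<le> z) \<Longrightarrow> Sup A \<le> z"
    unfolding Sup_ordinal_inf_def by (rule Least_le) blast
  show "Inf {} = (top :: 'a ordinal_inf)"
    by (auto simp: Inf_ordinal_inf_def top_ordinal_inf_def intro: Least_equality)
  show "Sup {} = (bot :: 'a ordinal_inf)"
  proof -
    have "Sup {} \<le> Ord (0 :: 'a ordinal)"
      unfolding Sup_ordinal_inf_def by (rule Least_le) simp
    then show ?thesis
      using zero_le
      by (auto simp: bot_ordinal_inf_def less_eq_ordinal_inf_def intro: antisym
          split: ordinal_inf.splits)
  qed
qed

end

instantiation ordinal_inf :: (type) "{plus, times}"
begin

definition plus_ordinal_inf :: "'a ordinal_inf \<Rightarrow> 'a ordinal_inf \<Rightarrow> 'a ordinal_inf" where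
  "(x :: 'a ordinal_inf) + y = (case (x, y) of (Ord \<alpha>, Ord \<beta>) \<Rightarrow> Ord (\<alpha> + \<beta>) | _ \<Rightarrow> Infty)"

definition times_ordinal_inf :: "'a ordinal_inf \<Rightarrow> 'a ordinal_inf \<Rightarrow> 'a ordinal_inf" where
  "(x :: 'a ordinal_inf) * y = (case (x, y) of (Ord \<alpha>, Ord \<beta>) \<Rightarrow> Ord (\<alpha> * \<beta>) | _ \<Rightarrow> Infty)"

instance ..

end


section \<open>Trees\<close>

text \<open>Trees are sets of lists; the initial segment order is \<^const>\<open>prefix\<close>.\<close>

definition prune :: "'v list set \<Rightarrow> 'v list set" where
  "prune T = T - {s \<in> T. \<not> (\<exists>t\<in>T. strict_prefix s t)}"

definition tree_deriv :: "'a ordinal \<Rightarrow> 'v list set \<Rightarrow> 'v list set" where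
  "tree_deriv \<xi> T = ord_rec T prune Inter \<xi>"

definition tree_order :: "'v list set \<Rightarrow> 'a ordinal_inf" where
  "tree_order T =
     (if \<exists>\<xi> :: 'a ordinal. tree_deriv \<xi> T = {}
      then Ord (LEAST \<xi>. tree_deriv \<xi> T = {}) else Infty)"


section \<open>Subspaces and quotients of a Banach space\<close>

text \<open>
  The types \<^typ>\<open>real\<close> and \<^typ>\<open>complex\<close> are instances of
  \<open>{real_normed_field, euclidean_space}\<close>, and up to isometric isomorphism there is no other
  instance (a normed field over the reals with multiplicative norm is one of these two).
  The real vector space structure of \<open>'v\<close> is recovered from \<open>scl\<close>: the condition on the norm
  makes \<open>r \<mapsto> scl (of_real r) x\<close> continuous, so it is \<open>r *\<^sub>R x\<close>.
\<close>

definition scalar_mult ::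
    "('k::{real_normed_field, euclidean_space} \<Rightarrow> 'v::real_normed_vector \<Rightarrow> 'v) \<Rightarrow> bool" where
  "scalar_mult scl \<longleftrightarrow> vector_space scl \<and> (\<forall>c x. norm (scl c x) = norm c * norm x)"

text \<open>
  A quotient by a subspace which is not fixed is not a type, so normed spaces over \<open>'k\<close> are
  handled through explicit carriers and operations.
\<close>

record ('k, 'v) nspace =
  points :: "'v set"
  add :: "'v \<Rightarrow> 'v \<Rightarrow> 'v"
  zer :: "'v"
  scale :: "'k \<Rightarrow> 'v \<Rightarrow> 'v"
  nrm :: "'v \<Rightarrow> real"

definition subspace_of :: "('k \<Rightarrow> 'v::real_normed_vector \<Rightarrow> 'v) \<Rightarrow> 'v set \<Rightarrow> ('k, 'v) nspace" where
  "subspace_of scl Y = \<lparr>points = Y, add = (+), zer = 0, scale = scl, nrm = norm\<rparr>"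

text \<open>
  Elements are the cosets of \<open>Y\<close>, with the usual quotient norm
  \<open>\<parallel>A\<parallel> = inf {\<parallel>a\<parallel> | a \<in> A}\<close>. Adding \<open>Y\<close> in \<open>scale\<close> matters only for the scalar \<open>0\<close>.
\<close>

definition quotient_by :: "('k \<Rightarrow> 'v::real_normed_vector \<Rightarrow> 'v) \<Rightarrow> 'v set \<Rightarrow> ('k, 'v set) nspace" where
  "quotient_by scl Y =
     \<lparr>points = {{x + y | y. y \<in> Y} | x. True},
      add = (\<lambda>A B. {a + b | a b. a \<in> A \<and> b \<in> B}),
      zer = Y,
      scale = (\<lambda>c A. {scl c a + y | a y. a \<in> A \<and> y \<in> Y}),
      nrm = (\<lambda>A. INF a\<in>A. norm a)\<rparr>"

definition lincomb :: "('k, 'v) nspace \<Rightarrow> 'k list \<Rightarrow> 'v list \<Rightarrow> 'v" where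
  "lincomb V as xs = foldr (\<lambda>(a, x) s. add V (scale V a x) s) (zip as xs) (zer V)"


section \<open>The trees \<open>T\<^sub>p(X, K)\<close> and the Bourgain-type indices\<close>

text \<open>The norm of \<open>\<ell>\<^sub>p\<^sup>n\<close> with \<open>n = length as\<close>; it is \<open>0\<close> for \<open>n = 0\<close>.\<close>

definition lp_norm :: "ennreal \<Rightarrow> 'k::real_normed_vector list \<Rightarrow> real" where
  "lp_norm p as =
     (if p = \<infinity> then Max (insert 0 (norm ` set as))
      else (\<Sum>a\<leftarrow>as. norm a powr enn2real p) powr (1 / enn2real p))"

definition T_tree ::
    "ennreal \<Rightarrow> ('k::real_normed_vector, 'v) nspace \<Rightarrow> real \<Rightarrow> 'v list set" where
  "T_tree p V K =
     {xs. (\<forall>x\<in>set xs. x \<in> points V \<and> nrm V x \<le> 1) \<and>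
          (\<forall>as. length as = length xs \<and> lp_norm p as = 1 \<longrightarrow>
             1 / K \<le> nrm V (lincomb V as xs) \<and> nrm V (lincomb V as xs) \<le> 1)}"

definition I_index_const ::
    "ennreal \<Rightarrow> ('k::real_normed_vector, 'v) nspace \<Rightarrow> real \<Rightarrow> 'a ordinal_inf" where
  "I_index_const p V K = tree_order (T_tree p V K)"

definition I_index :: "ennreal \<Rightarrow> ('k::real_normed_vector, 'v) nspace \<Rightarrow> 'a ordinal_inf" where
  "I_index p V = (SUP K\<in>{1..}. I_index_const p V K)"


section \<open>Schreier families and spreading models\<close>

text \<open>Here the natural numbers start with \<open>1\<close>.\<close>

definition family_comp :: "nat set set \<Rightarrow> nat set set \<Rightarrow> nat set set" where
  "family_comp F G =
     {E. E = {} \<or>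
         (\<exists>s (Es :: nat \<Rightarrow> nat set).
            E = (\<Union>i\<in>{1..s}. Es i) \<and>
            (\<forall>i\<in>{1..s}. Es i \<noteq> {} \<and> Es i \<in> G) \<and>
            (\<forall>i\<in>{1..<s}. Max (Es i) < Min (Es (Suc i))) \<and>
            (\<lambda>i. Min (Es i)) ` {1..s} \<in> F)}"

definition schreier1 :: "nat set set" where
  "schreier1 = {E. E = {} \<or> finite E \<and> E \<subseteq> {1..} \<and> card E \<le> Min E}"

text \<open>
  \<open>S\<close> is a system of Schreier families \<open>(S\<^sub>\<xi>)\<close>, \<open>\<xi> \<le> \<omega>\<^sub>1\<close>, for some choice of the sequences
  \<open>\<xi>\<^sub>n \<up> \<xi>\<close> at the limit ordinals; its values beyond \<open>\<omega>\<^sub>1\<close> are irrelevant. The condition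
  \<open>n \<le> min E\<close> is void for \<open>E = \<emptyset>\<close>.
\<close>

definition schreier_families :: "('a ordinal \<Rightarrow> nat set set) \<Rightarrow> bool" where
  "schreier_families S \<longleftrightarrow>
     S 0 = {E. finite E \<and> E \<subseteq> {1..} \<and> card E \<le> 1} \<and>
     (\<forall>\<xi><omega1. S (osucc \<xi>) = family_comp schreier1 (S \<xi>)) \<and>
     (\<forall>\<xi><omega1. is_limit \<xi> \<longrightarrow>
        (\<exists>\<xi>s :: nat \<Rightarrow> 'a ordinal.
           (\<forall>n\<ge>1. \<xi>s n < \<xi> \<and> \<xi>s n < \<xi>s (Suc n)) \<and>
           (\<forall>\<zeta><\<xi>. \<exists>n\<ge>1. \<zeta> < \<xi>s n) \<and>
           (\<forall>n\<ge>1. S (osucc (\<xi>s n)) \<subseteq> S (\<xi>s (Suc n))) \<and>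
           S \<xi> = {E. E = {} \<or> (\<exists>n\<ge>1. n \<le> Min E \<and> E \<in> S (osucc (\<xi>s n)))})) \<and>
     S omega1 = {E. finite E \<and> E \<subseteq> {1..}}"

text \<open>For \<open>p = \<infinity>\<close> these are the \<open>K\<close>-\<open>c\<^sub>0\<^sup>\<xi>\<close> spreading models.\<close>

definition spreading_model ::
    "('a ordinal \<Rightarrow> nat set set) \<Rightarrow> ennreal \<Rightarrow> ('k::real_normed_vector, 'v) nspace \<Rightarrow> real \<Rightarrow>
     'a ordinal \<Rightarrow> (nat \<Rightarrow> 'v) \<Rightarrow> bool" where
  "spreading_model S p V K \<xi> x \<longleftrightarrow>
     (\<forall>n\<ge>1. x n \<in> points V) \<and>
     (\<forall>E\<in>S \<xi>. map x (sorted_list_of_set E) \<in> T_tree p V K)"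

definition SM_index_const ::
    "('a ordinal \<Rightarrow> nat set set) \<Rightarrow> ennreal \<Rightarrow> ('k::real_normed_vector, 'v) nspace \<Rightarrow> real \<Rightarrow>
     'a ordinal_inf" where
  "SM_index_const S p V K =
     (if \<exists>\<xi>\<le>omega1. \<nexists>x. spreading_model S p V K \<xi> x
      then Ord (LEAST \<xi>. \<xi> \<le> omega1 \<and> (\<nexists>x. spreading_model S p V K \<xi> x)) else Infty)"

definition SM_index ::
    "('a ordinal \<Rightarrow> nat set set) \<Rightarrow> ennreal \<Rightarrow> ('k::real_normed_vector, 'v) nspace \<Rightarrow>
     'a ordinal_inf" where
  "SM_index S p V = (SUP K\<in>{1..}. SM_index_const S p V K)"

end

theory Submission
  imports Defs
begin

text \<open>
  All five inequalities rest on one construction.  Let \<open>q\<close> be the quotient map and suppose that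
  vectors of \<open>X\<close> satisfy \<open>\<ell>\<^sub>p\<close> estimates.  Where their images in \<open>X/Y\<close> fail to do so, it is the lower
  estimate that fails, so there is a normalized combination \<open>z\<close> with \<open>q z\<close> small
  (\<open>combination_close_to_subspace\<close>), and hence some \<open>y \<in> Y\<close> close to \<open>z\<close>.  Successive combinations of
  this kind again satisfy the \<open>\<ell>\<^sub>p\<close> estimates, and small perturbations preserve them
  (\<open>perturbed_blocks\<close>): the vectors \<open>y\<close> form an \<open>\<ell>\<^sub>p\<close> system in \<open>Y\<close>.  For general \<open>p\<close> the
  perturbations have to be summable, so arbitrarily good approximations are required and all
  constants of \<open>X/Y\<close> enter.  For \<open>p = 1\<close> a constant error \<open>1 / (3 K)\<close> is small enough.  The
  predicate \<open>dual_bound\<close> covers both cases.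

  For the Bourgain indices, suppose that no tree of \<open>X/Y\<close> survives \<open>\<alpha>\<close> derivations.  Then each
  block costs at most \<open>\<alpha>\<close> derivations of the tree of \<open>X\<close>, and each derivation of the tree of \<open>Y\<close> is
  paid by one block.  So the tree of \<open>Y\<close> survives \<open>\<beta>\<close> derivations if the one of \<open>X\<close> survives
  \<open>\<alpha> \<beta>\<close> (\<open>block_tree_deriv\<close>).

  For the spreading model indices, blocks are supported on sets from \<open>S \<xi>\<close>, and estimates on
  \<open>S (\<xi> + \<zeta>)\<close> cover those unions of blocks whose index sets lie in \<open>S \<zeta>\<close>, after passing to a
  subsequence (\<open>schreier_sum\<close>).  If the sum reaches \<open>\<omega>\<^sub>1\<close>, the same argument works with all finite
  sets.

  For \<open>c\<^sub>0\<close> there is a dichotomy.  If \<open>q x\<^sub>n\<close> has a null subsequence, single vectors serve as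
  blocks and no Schreier index is lost in \<open>Y\<close>.  Otherwise \<open>(q x\<^sub>n)\<close> is seminormalized with upper
  \<open>c\<^sub>0\<close> estimates.  Means over Schreier sets then tend to \<open>0\<close>, which yields a subsequence that is
  almost basic (\<open>mazur_step\<close>, \<open>basic_subsequence\<close>) and therefore has lower \<open>c\<^sub>0\<close> estimates.

  Seminorms of the quotient are computed in \<open>X\<close>, as distances to \<open>Y\<close>.
\<close>


section \<open>Ordinal arithmetic\<close>

lemma zero_le_ordinal: "(0 :: 'a ordinal) \<le> \<alpha>"
  unfolding zero_ordinal_def by (rule Least_le) simp

lemma ordinal_induct [case_names zero succ limit]:
  fixes P :: "'a ordinal \<Rightarrow> bool"
  assumes "P 0"
    and "\<And>\<zeta>. P \<zeta> \<Longrightarrow> P (osucc \<zeta>)"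
    and "\<And>\<xi>. is_limit \<xi> \<Longrightarrow> (\<And>\<zeta>. \<zeta> < \<xi> \<Longrightarrow> P \<zeta>) \<Longrightarrow> P \<xi>"
  shows "P \<xi>"
proof (induction \<xi> rule: less_induct)
  case (less \<xi>)
  then show ?case
    using assms less_osucc unfolding is_limit_def by metis
qed

lemma le_osucc_iff: "\<eta> \<le> osucc \<xi> \<longleftrightarrow> \<eta> = osucc \<xi> \<or> \<eta> \<le> \<xi>"
  by (metis less_osucc nle_le order.strict_implies_order order.trans osucc_le linorder_not_le)

lemma osucc_less_limit: "is_limit \<xi> \<Longrightarrow> \<zeta> < \<xi> \<Longrightarrow> osucc \<zeta> < \<xi>"
  by (metis is_limit_def order.not_eq_order_implies_strict osucc_le)

text \<open>
  The order type of \<^typ>\<open>'a ordinal\<close> is a successor cardinal, hence regular, whereas every proper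
  initial segment has smaller cardinality.  This is the only reason why suprema of such families
  exist inside the type.
\<close>

lemma bounded_image_initial_segment:
  includes cardinal_syntax
  fixes f :: "'a ordinal \<Rightarrow> 'a ordinal"
  shows "\<exists>\<beta>. \<forall>\<zeta><\<xi>. f \<zeta> \<le> \<beta>"
proof -
  let ?c = "card_of (UNIV :: (real \<times> 'a) set)"
  let ?r = "ordinal_rel :: (real \<times> 'a) set rel"
  let ?B = "Rep_ordinal ` f ` {\<zeta>. \<zeta> < \<xi>}"
  define As where "As = (\<lambda>i. {x. (x, i) \<in> ?r})"
  have trans: "trans ?r" and refl: "refl_on (Field ?r) ?r"
    using ordinal_rel_Well_order
    unfolding well_order_on_def linear_order_on_def partial_order_on_def preorder_on_def by auto
  have "Rep_ordinal ` {\<zeta>. \<zeta> < \<xi>} \<subseteq> underS ?r (Rep_ordinal \<xi>)"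
    by (auto simp: underS_def less_ordinal_def less_eq_ordinal_def Rep_ordinal_inject)
  then have "card_of (Rep_ordinal ` {\<zeta>. \<zeta> < \<xi>}) \<le>o card_of (underS ?r (Rep_ordinal \<xi>))"
    by (rule card_of_mono1)
  also have "card_of (underS ?r (Rep_ordinal \<xi>)) <o ?r"
    using ordinal_rel_Card_order Rep_ordinal by (rule card_of_underS)
  finally have small: "card_of (Rep_ordinal ` {\<zeta>. \<zeta> < \<xi>}) <o ?r" .
  have "?B = (\<lambda>r. Rep_ordinal (f (Abs_ordinal r))) ` Rep_ordinal ` {\<zeta>. \<zeta> < \<xi>}"
    by (simp add: image_image Rep_ordinal_inverse)
  then have "card_of ?B \<le>o card_of (Rep_ordinal ` {\<zeta>. \<zeta> < \<xi>})"
    by (metis card_of_image)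
  then have "card_of ?B <o ?r"
    using small by (rule ordLeq_ordLess_trans)
  then have "card_of ?B \<le>o ?c"
    by (simp add: cardSuc_ordLeq_ordLess card_of_Card_order)
  moreover have "relChain ?r As"
    using trans unfolding relChain_def As_def by (auto dest: transD)
  moreover have "?B \<subseteq> (\<Union>i\<in>Field ?r. As i)"
    using refl Rep_ordinal unfolding As_def refl_on_def by blast
  moreover have "infinite (UNIV :: (real \<times> 'a) set)"
    by (simp add: finite_prod infinite_UNIV_char_0)
  then have "infinite (Field ?c)"
    by (simp only: Field_card_of not_False_eq_True)
  ultimately obtain i where "i \<in> Field ?r" "?B \<subseteq> As i"
    using cardSuc_UNION[of ?c As ?B] card_of_Card_order by metis
  then have "\<forall>\<zeta><\<xi>. f \<zeta> \<le> Abs_ordinal i"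
    by (auto simp: less_eq_ordinal_def Abs_ordinal_inverse As_def)
  then show ?thesis ..
qed

lemma le_osup_initial_segment:
  fixes \<xi> :: "'a ordinal" and f :: "'a ordinal \<Rightarrow> 'a ordinal"
  shows "\<zeta> < \<xi> \<Longrightarrow> f \<zeta> \<le> osup (f ` {\<zeta>. \<zeta> < \<xi>})"
proof -
  assume "\<zeta> < \<xi>"
  obtain \<beta> where "\<forall>\<alpha>\<in>f ` {\<zeta>. \<zeta> < \<xi>}. \<alpha> \<le> \<beta>"
    using bounded_image_initial_segment[of \<xi> f] by auto
  then have "\<forall>\<alpha>\<in>f ` {\<zeta>. \<zeta> < \<xi>}. \<alpha> \<le> osup (f ` {\<zeta>. \<zeta> < \<xi>})"
    unfolding osup_def by (rule LeastI)
  with \<open>\<zeta> < \<xi>\<close> show ?thesis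
    by blast
qed

lemma add_zero_ordinal [simp]: "\<alpha> + 0 = (\<alpha> :: 'a ordinal)"
  by (simp add: plus_ordinal_def ord_rec_0)

lemma add_osucc [simp]: "\<alpha> + osucc \<beta> = osucc (\<alpha> + \<beta>)"
  by (simp add: plus_ordinal_def ord_rec_osucc)

lemma add_le_add_limit: "is_limit \<beta> \<Longrightarrow> \<gamma> < \<beta> \<Longrightarrow> \<alpha> + \<gamma> \<le> \<alpha> + \<beta>"
  using le_osup_initial_segment[of \<gamma> \<beta> "ord_rec \<alpha> osucc osup"]
  by (simp add: plus_ordinal_def ord_rec_limit)

lemma add_left_mono_ordinal: "\<gamma> \<le> \<beta> \<Longrightarrow> \<alpha> + \<gamma> \<le> \<alpha> + (\<beta> :: 'a ordinal)"
proof (induction \<beta> rule: ordinal_induct)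
  case zero
  then show ?case using zero_le_ordinal[of \<gamma>] by simp
next
  case (succ \<zeta>)
  then show ?case by (auto simp: le_osucc_iff)
next
  case (limit \<beta>)
  then show ?case using add_le_add_limit[of \<beta> \<gamma>] by (cases "\<gamma> = \<beta>") auto
qed

lemma le_add_left_ordinal: "\<alpha> \<le> \<alpha> + (\<beta> :: 'a ordinal)"
  using add_left_mono_ordinal[of 0 \<beta> \<alpha>] zero_le_ordinal[of \<beta>] by simp

lemma le_add_right_ordinal: "\<beta> \<le> \<alpha> + (\<beta> :: 'a ordinal)"
proof (induction \<beta> rule: ordinal_induct)
  case zero
  show ?case by (rule zero_le_ordinal)
next
  case (succ \<beta>)
  then show ?case by (metis add_osucc less_osucc order.strict_trans1 osucc_le)
next
  case (limit \<beta>)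
  show ?case
  proof (rule leI, rule notI)
    assume "\<alpha> + \<beta> < \<beta>"
    then have less: "osucc (\<alpha> + \<beta>) < \<beta>"
      using limit(1) osucc_less_limit by blast
    then have "osucc (\<alpha> + \<beta>) \<le> \<alpha> + osucc (\<alpha> + \<beta>)"
      using limit(2) by blast
    also have "\<dots> \<le> \<alpha> + \<beta>"
      using less limit(1) add_le_add_limit by blast
    finally show False
      using less_osucc leD by blast
  qed
qed

lemma mult_zero_ordinal [simp]: "\<alpha> * 0 = (0 :: 'a ordinal)"
  by (simp add: times_ordinal_def ord_rec_0)

lemma mult_osucc [simp]: "\<alpha> * osucc \<beta> = \<alpha> * \<beta> + \<alpha>"
  by (simp add: times_ordinal_def ord_rec_osucc)

lemma mult_le_mult_limit: "is_limit \<beta> \<Longrightarrow> \<gamma> < \<beta> \<Longrightarrow> \<alpha> * \<gamma> \<le> \<alpha> * \<beta>"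
  using le_osup_initial_segment[of \<gamma> \<beta> "ord_rec 0 (\<lambda>\<gamma>. \<gamma> + \<alpha>) osup"]
  by (simp add: times_ordinal_def ord_rec_limit)

lemma Ord_le_Ord_iff [simp]: "Ord \<alpha> \<le> Ord \<beta> \<longleftrightarrow> \<alpha> \<le> \<beta>"
  by (simp add: less_eq_ordinal_inf_def)

lemma le_Infty [simp]: "x \<le> Infty"
  by (simp add: less_eq_ordinal_inf_def)

lemma not_Infty_le_Ord [simp]: "\<not> Infty \<le> Ord \<beta>"
  by (simp add: less_eq_ordinal_inf_def)

lemma le_mult_ordinal_inf:
  assumes "\<And>\<alpha> \<beta>. y = Ord \<alpha> \<Longrightarrow> z = Ord \<beta> \<Longrightarrow> x \<le> Ord (\<alpha> * \<beta>)"
  shows "x \<le> y * z"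
  using assms by (cases y; cases z) (simp_all add: times_ordinal_inf_def)

lemma le_plus_ordinal_inf:
  assumes "\<And>\<alpha> \<beta>. y = Ord \<alpha> \<Longrightarrow> z = Ord \<beta> \<Longrightarrow> x \<le> Ord (\<alpha> + \<beta>)"
  shows "x \<le> y + z"
  using assms by (cases y; cases z) (simp_all add: plus_ordinal_inf_def)


section \<open>Derivatives of trees\<close>

lemma tree_deriv_zero [simp]: "tree_deriv 0 T = T"
  by (simp add: tree_deriv_def ord_rec_0)

lemma tree_deriv_osucc [simp]: "tree_deriv (osucc \<xi>) T = prune (tree_deriv \<xi> T)"
  by (simp add: tree_deriv_def ord_rec_osucc)

lemma tree_deriv_limit: "is_limit \<xi> \<Longrightarrow> tree_deriv \<xi> T = (\<Inter>\<zeta>\<in>{\<zeta>. \<zeta> < \<xi>}. tree_deriv \<zeta> T)"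
  by (simp add: tree_deriv_def ord_rec_limit)

lemma mem_prune_iff: "s \<in> prune T \<longleftrightarrow> s \<in> T \<and> (\<exists>t\<in>T. strict_prefix s t)"
  by (auto simp: prune_def)

lemma prune_mono: "T \<subseteq> U \<Longrightarrow> prune T \<subseteq> prune U"
  unfolding subset_iff mem_prune_iff by blast

lemma tree_deriv_antimono: "\<zeta> \<le> \<xi> \<Longrightarrow> tree_deriv \<xi> T \<subseteq> tree_deriv \<zeta> T"
proof (induction \<xi> rule: ordinal_induct)
  case zero
  then show ?case using zero_le_ordinal[of \<zeta>] by simp
next
  case (succ \<xi>)
  then show ?case by (auto simp: le_osucc_iff mem_prune_iff)
next
  case (limit \<xi>)
  then show ?case by (cases "\<zeta> = \<xi>") (auto simp: tree_deriv_limit)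
qed

lemma tree_deriv_add: "tree_deriv (\<rho> + \<alpha>) T \<subseteq> tree_deriv \<alpha> (tree_deriv \<rho> T)"
proof (induction \<alpha> rule: ordinal_induct)
  case (succ \<alpha>)
  then show ?case by (simp add: prune_mono)
next
  case (limit \<alpha>)
  have "tree_deriv (\<rho> + \<alpha>) T \<subseteq> tree_deriv \<delta> (tree_deriv \<rho> T)" if "\<delta> < \<alpha>" for \<delta>
    using limit(2)[OF that] tree_deriv_antimono[OF add_le_add_limit[OF limit(1) that]] by blast
  then show ?case
    by (auto simp: tree_deriv_limit limit(1))
qed simp

text \<open>
  A map which preserves strict extension carries derivatives into derivatives.  It is only
  required above a given node \<open>s\<close>, so that the subtree of the extensions of \<open>s\<close> can be mapped
  into another tree.
\<close>

lemma tree_deriv_map: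
  assumes mem: "\<And>t. t \<in> T \<Longrightarrow> prefix s t \<Longrightarrow> f t \<in> U"
    and strict: "\<And>t t'. prefix s t \<Longrightarrow> strict_prefix t t' \<Longrightarrow> strict_prefix (f t) (f t')"
    and "t \<in> tree_deriv \<xi> T" "prefix s t"
  shows "f t \<in> tree_deriv \<xi> U"
  using assms(3,4)
proof (induction \<xi> arbitrary: t rule: ordinal_induct)
  case zero
  then show ?case by (simp add: mem)
next
  case (succ \<xi>)
  then obtain t' where "t \<in> tree_deriv \<xi> T" "t' \<in> tree_deriv \<xi> T" "strict_prefix t t'"
    by (auto simp: mem_prune_iff)
  moreover from this have "prefix s t'"
    using succ.prems by (auto simp: strict_prefix_def)
  ultimately show ?case
    using succ strict[of t t'] by (auto simp: mem_prune_iff)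
next
  case (limit \<xi>)
  then show ?case by (auto simp: tree_deriv_limit)
qed

lemma Nil_in_tree_deriv:
  assumes "[] \<in> T" "tree_deriv \<xi> T \<noteq> {}"
  shows "[] \<in> tree_deriv \<xi> T"
  using assms(2)
proof (induction \<xi> rule: ordinal_induct)
  case zero
  then show ?case by (simp add: assms)
next
  case (succ \<xi>)
  then obtain s t where st: "t \<in> tree_deriv \<xi> T" "strict_prefix s t"
    by (auto simp: mem_prune_iff)
  then have "strict_prefix [] t"
    by (cases t) auto
  then show ?case
    using st(1) succ.IH by (auto simp: mem_prune_iff)
next
  case (limit \<xi>)
  then show ?case by (auto simp: tree_deriv_limit)
qed

lemma tree_order_le_iff: "tree_order T \<le> Ord \<alpha> \<longleftrightarrow> tree_deriv \<alpha> T = {}"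
proof
  assume le: "tree_order T \<le> Ord \<alpha>"
  then have ex: "\<exists>\<xi> :: 'a ordinal. tree_deriv \<xi> T = {}"
    by (auto simp: tree_order_def split: if_splits)
  then have "tree_deriv (LEAST \<xi> :: 'a ordinal. tree_deriv \<xi> T = {}) T = {}"
    by (rule LeastI_ex)
  moreover have "(LEAST \<xi>. tree_deriv \<xi> T = {}) \<le> \<alpha>"
    using le ex by (simp add: tree_order_def)
  ultimately show "tree_deriv \<alpha> T = {}"
    using tree_deriv_antimono by blast
next
  assume "tree_deriv \<alpha> T = {}"
  then show "tree_order T \<le> Ord \<alpha>"
    by (auto simp: tree_order_def intro: Least_le)
qed


section \<open>Schreier families\<close>

text \<open>
  Since the minima of successive sets are distinct, \<open>{min E\<^sub>1, \<dots>, min E\<^sub>s}\<close> is a Schreier set iff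
  all elements of all \<open>E\<^sub>i\<close> are at least \<open>s\<close>.  In this form, without \<open>Min\<close>, \<open>Max\<close> and \<open>card\<close>,
  the condition is visibly stable under moving the elements to the right.
\<close>

lemma family_comp_schreier1_iff:
  assumes fin: "\<And>E. E \<in> G \<Longrightarrow> finite E"
  shows "E \<in> family_comp schreier1 G \<longleftrightarrow>
    (\<exists>s (Es :: nat \<Rightarrow> nat set). E = (\<Union>i\<in>{1..s}. Es i) \<and>
       (\<forall>i\<in>{1..s}. Es i \<noteq> {} \<and> Es i \<in> G \<and> (\<forall>x\<in>Es i. s \<le> x)) \<and>
       (\<forall>i\<in>{1..<s}. \<forall>x\<in>Es i. \<forall>y\<in>Es (Suc i). x < y))"
    (is "?L \<longleftrightarrow> (\<exists>s Es. ?P s Es)")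
proof
  assume ?L
  show "\<exists>s Es. ?P s Es"
  proof (cases "E = {}")
    case True
    then have "?P 0 (\<lambda>_. {})" by simp
    then show ?thesis by blast
  next
    case False
    with \<open>?L\<close> obtain s and Es :: "nat \<Rightarrow> nat set" where
      E: "E = (\<Union>i\<in>{1..s}. Es i)" and
      mem: "\<forall>i\<in>{1..s}. Es i \<noteq> {} \<and> Es i \<in> G" and
      succ: "\<forall>i\<in>{1..<s}. Max (Es i) < Min (Es (Suc i))" and
      S: "(\<lambda>i. Min (Es i)) ` {1..s} \<in> schreier1"
      unfolding family_comp_def by blast
    let ?g = "\<lambda>i. Min (Es i)"
    have finE: "finite (Es i)" if "i \<in> {1..s}" for i
      using mem fin that by blast
    have step: "\<forall>x\<in>Es i. \<forall>y\<in>Es (Suc i). x < y" if "i \<in> {1..<s}" for i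
    proof -
      have "finite (Es i)" "finite (Es (Suc i))" "Max (Es i) < Min (Es (Suc i))"
        using finE[of i] finE[of "Suc i"] succ that by auto
      then show ?thesis by (meson Max_ge Min_le order.strict_trans1 order.strict_trans2)
    qed
    have gs: "?g i < ?g (Suc i)" if "i \<in> {1..<s}" for i
      using step[OF that] Min_in[of "Es i"] Min_in[of "Es (Suc i)"] finE[of i] finE[of "Suc i"]
        mem that by auto
    have "i < j \<Longrightarrow> 1 \<le> i \<Longrightarrow> j \<le> s \<Longrightarrow> ?g i < ?g j" for i j
    proof (induction j)
      case (Suc j)
      then show ?case
        using gs[of j] by (cases "i = j") auto
    qed simp
    then have "inj_on ?g {1..s}"
      by (intro linorder_inj_onI) (fastforce simp: less_imp_neq, auto)
    then have card: "card (?g ` {1..s}) = s"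
      by (simp add: card_image)
    have "s \<le> x" if "i \<in> {1..s}" "x \<in> Es i" for i x
    proof -
      have "s \<le> Min (?g ` {1..s})"
        using S card that unfolding schreier1_def by auto
      also have "\<dots> \<le> ?g i"
        using that by (intro Min_le) auto
      also have "\<dots> \<le> x"
        using that finE by (intro Min_le) auto
      finally show ?thesis .
    qed
    with E mem step have "?P s Es" by blast
    then show ?thesis by blast
  qed
next
  assume "\<exists>s Es. ?P s Es"
  then obtain s Es where P: "?P s Es" by blast
  let ?g = "\<lambda>i. Min (Es i)"
  have finE: "finite (Es i)" if "i \<in> {1..s}" for i
    using P fin that by blast
  have le: "s \<le> ?g i" if "i \<in> {1..s}" for i
    using P Min_in[OF finE[OF that]] that by blast
  have "card (?g ` {1..s}) \<le> s"
    using card_image_le[of "{1..s}" ?g] by simp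
  then have "?g ` {1..s} \<in> schreier1"
    using le unfolding schreier1_def by (auto simp: Min_ge_iff) force+
  moreover have "Max (Es i) < Min (Es (Suc i))" if "i \<in> {1..<s}" for i
  proof -
    have "finite (Es i)" "finite (Es (Suc i))" "Es i \<noteq> {}" "Es (Suc i) \<noteq> {}"
      using finE[of i] finE[of "Suc i"] P that by auto
    with P that show ?thesis by (simp add: Max_less_iff Min_gr_iff)
  qed
  ultimately show ?L
    using P unfolding family_comp_def by blast
qed

lemma schreier_zero: "schreier_families S \<Longrightarrow> S 0 = {E. finite E \<and> E \<subseteq> {1..} \<and> card E \<le> 1}"
  unfolding schreier_families_def by (elim conjE)

lemma schreier_osucc:
  assumes "schreier_families S" "osucc \<xi> < omega1"
  shows "S (osucc \<xi>) = family_comp schreier1 (S \<xi>)"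
proof -
  have "\<forall>\<xi><omega1. S (osucc \<xi>) = family_comp schreier1 (S \<xi>)"
    using assms(1) unfolding schreier_families_def by (elim conjE)
  moreover have "\<xi> < omega1"
    using less_osucc assms(2) by (rule order.strict_trans)
  ultimately show ?thesis by simp
qed

lemma schreier_limit:
  assumes "schreier_families S" "is_limit \<xi>" "\<xi> < omega1"
  obtains \<xi>s :: "nat \<Rightarrow> 'a ordinal" where
    "\<forall>n\<ge>1. osucc (\<xi>s n) < \<xi>" "\<forall>\<zeta><\<xi>. \<exists>n\<ge>1. \<zeta> \<le> osucc (\<xi>s n)"
    "S \<xi> = {E. E = {} \<or> (\<exists>n\<ge>1. n \<le> Min E \<and> E \<in> S (osucc (\<xi>s n)))}"
proof -
  have "\<forall>\<xi><omega1. is_limit \<xi> \<longrightarrow>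
    (\<exists>\<xi>s :: nat \<Rightarrow> 'a ordinal.
       (\<forall>n\<ge>1. \<xi>s n < \<xi> \<and> \<xi>s n < \<xi>s (Suc n)) \<and>
       (\<forall>\<zeta><\<xi>. \<exists>n\<ge>1. \<zeta> < \<xi>s n) \<and>
       (\<forall>n\<ge>1. S (osucc (\<xi>s n)) \<subseteq> S (\<xi>s (Suc n))) \<and>
       S \<xi> = {E. E = {} \<or> (\<exists>n\<ge>1. n \<le> Min E \<and> E \<in> S (osucc (\<xi>s n)))})"
    using assms(1) unfolding schreier_families_def by (elim conjE)
  with assms(2,3) obtain \<xi>s :: "nat \<Rightarrow> 'a ordinal" where
    \<xi>s: "\<forall>n\<ge>1. \<xi>s n < \<xi>" "\<forall>\<zeta><\<xi>. \<exists>n\<ge>1. \<zeta> < \<xi>s n"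
    "S \<xi> = {E. E = {} \<or> (\<exists>n\<ge>1. n \<le> Min E \<and> E \<in> S (osucc (\<xi>s n)))}"
    by (elim allE[of _ \<xi>]) auto
  show thesis
  proof (rule that[of \<xi>s])
    show "\<forall>n\<ge>1. osucc (\<xi>s n) < \<xi>"
      using osucc_less_limit[OF assms(2)] \<xi>s(1) by blast
    show "\<forall>\<zeta><\<xi>. \<exists>n\<ge>1. \<zeta> \<le> osucc (\<xi>s n)"
      using \<xi>s(2) less_osucc order.strict_trans order.strict_implies_order by blast
  qed (rule \<xi>s(3))
qed

lemma schreier_omega1: "schreier_families S \<Longrightarrow> S omega1 = {E. finite E \<and> E \<subseteq> {1..}}"
  unfolding schreier_families_def by (elim conjE)

lemma schreier_finite:
  assumes "schreier_families S"
  shows "\<xi> \<le> omega1 \<Longrightarrow> E \<in> S \<xi> \<Longrightarrow> finite E \<and> E \<subseteq> {1..}"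
proof (cases "\<xi> = omega1")
  case False
  have "\<xi> < omega1 \<Longrightarrow> \<forall>E\<in>S \<xi>. finite E \<and> E \<subseteq> {1..}"
  proof (induction \<xi> rule: ordinal_induct)
    case zero
    then show ?case using assms by (auto simp: schreier_zero)
  next
    case (succ \<xi>)
    then have IH: "\<forall>E\<in>S \<xi>. finite E \<and> E \<subseteq> {1..}"
      using less_osucc order.strict_trans by blast
    show ?case
    proof
      fix E assume "E \<in> S (osucc \<xi>)"
      then obtain s and Es :: "nat \<Rightarrow> nat set" where
        "E = (\<Union>i\<in>{1..s}. Es i)" "\<forall>i\<in>{1..s}. Es i \<in> S \<xi>"
        using IH by (auto simp: schreier_osucc[OF assms succ.prems] family_comp_schreier1_iff)
      with IH show "finite E \<and> E \<subseteq> {1..}" by blast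
    qed
  next
    case (limit \<xi>)
    obtain \<xi>s :: "nat \<Rightarrow> 'a ordinal" where \<xi>s:
      "\<forall>n\<ge>1. osucc (\<xi>s n) < \<xi>" "\<forall>\<zeta><\<xi>. \<exists>n\<ge>1. \<zeta> \<le> osucc (\<xi>s n)"
      "S \<xi> = {E. E = {} \<or> (\<exists>n\<ge>1. n \<le> Min E \<and> E \<in> S (osucc (\<xi>s n)))}"
      using schreier_limit[OF assms limit(1,3)] .
    have IH: "\<forall>E\<in>S (osucc (\<xi>s n)). finite E \<and> E \<subseteq> {1..}" if "1 \<le> n" for n
    proof -
      have "osucc (\<xi>s n) < \<xi>" using \<xi>s(1) that by blast
      then show ?thesis
        using limit.IH[of "osucc (\<xi>s n)"] limit.prems order.strict_trans by blast
    qed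
    show ?case
      unfolding \<xi>s(3) using IH by blast
  qed
  then show "\<xi> \<le> omega1 \<Longrightarrow> E \<in> S \<xi> \<Longrightarrow> finite E \<and> E \<subseteq> {1..}"
    using False by simp
qed (use assms in \<open>auto simp: schreier_omega1\<close>)

lemma schreier_osucc_iff:
  assumes "schreier_families S" "osucc \<xi> < omega1"
  shows "E \<in> S (osucc \<xi>) \<longleftrightarrow>
    (\<exists>s (Es :: nat \<Rightarrow> nat set). E = (\<Union>i\<in>{1..s}. Es i) \<and>
       (\<forall>i\<in>{1..s}. Es i \<noteq> {} \<and> Es i \<in> S \<xi> \<and> (\<forall>x\<in>Es i. s \<le> x)) \<and>
       (\<forall>i\<in>{1..<s}. \<forall>x\<in>Es i. \<forall>y\<in>Es (Suc i). x < y))"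
  unfolding schreier_osucc[OF assms]
  using schreier_finite[OF assms(1), of \<xi>] assms(2) less_osucc[of \<xi>]
  by (intro family_comp_schreier1_iff) auto

lemma schreier_subset_osucc:
  assumes "schreier_families S" "osucc \<xi> < omega1"
  shows "S \<xi> \<subseteq> S (osucc \<xi>)"
proof
  fix E assume E: "E \<in> S \<xi>"
  then have "E \<subseteq> {1..}"
    using schreier_finite[OF assms(1), of \<xi> E] assms(2) less_osucc[of \<xi>] by auto
  show "E \<in> S (osucc \<xi>)"
  proof (cases "E = {}")
    case True
    then show ?thesis
      unfolding schreier_osucc_iff[OF assms] by (intro exI[of _ 0]) auto
  next
    case False
    with E \<open>E \<subseteq> {1..}\<close> show ?thesis
      unfolding schreier_osucc_iff[OF assms]
      by (intro exI[of _ 1] exI[of _ "\<lambda>_. E"]) auto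
  qed
qed

lemma schreier_limit_iff:
  assumes "schreier_families S" "is_limit \<xi>" "\<xi> < omega1"
  obtains \<xi>s :: "nat \<Rightarrow> 'a ordinal" where
    "\<And>n. 1 \<le> n \<Longrightarrow> osucc (\<xi>s n) < \<xi>" "\<And>\<zeta>. \<zeta> < \<xi> \<Longrightarrow> \<exists>n\<ge>1. \<zeta> \<le> osucc (\<xi>s n)"
    "\<And>E. E \<in> S \<xi> \<longleftrightarrow> E = {} \<or> (\<exists>n\<ge>1. (\<forall>x\<in>E. n \<le> x) \<and> E \<in> S (osucc (\<xi>s n)))"
proof -
  obtain \<xi>s :: "nat \<Rightarrow> 'a ordinal" where \<xi>s:
    "\<forall>n\<ge>1. osucc (\<xi>s n) < \<xi>" "\<forall>\<zeta><\<xi>. \<exists>n\<ge>1. \<zeta> \<le> osucc (\<xi>s n)"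
    "S \<xi> = {E. E = {} \<or> (\<exists>n\<ge>1. n \<le> Min E \<and> E \<in> S (osucc (\<xi>s n)))}"
    using schreier_limit[OF assms] .
  have "n \<le> Min E \<longleftrightarrow> (\<forall>x\<in>E. n \<le> x)" if "1 \<le> n" "E \<in> S (osucc (\<xi>s n))" "E \<noteq> {}" for n E
  proof -
    have "osucc (\<xi>s n) < \<xi>" using \<xi>s(1) that by blast
    then have "osucc (\<xi>s n) \<le> omega1" using assms(3) by simp
    then have "finite E" using schreier_finite[OF assms(1)] that by blast
    with that show ?thesis by (simp add: Min_ge_iff)
  qed
  then have "E \<in> S \<xi> \<longleftrightarrow> E = {} \<or> (\<exists>n\<ge>1. (\<forall>x\<in>E. n \<le> x) \<and> E \<in> S (osucc (\<xi>s n)))" for E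
    unfolding \<xi>s(3) by blast
  then show thesis
    using \<xi>s(1,2) by (intro that[of \<xi>s]) blast+
qed

lemma schreier_empty:
  assumes "schreier_families S" "\<xi> \<le> omega1"
  shows "{} \<in> S \<xi>"
proof (cases "\<xi> = omega1")
  case False
  have "\<xi> < omega1 \<Longrightarrow> {} \<in> S \<xi>"
  proof (induction \<xi> rule: ordinal_induct)
    case (succ \<xi>)
    then show ?case
      using schreier_subset_osucc[OF assms(1)] less_osucc order.strict_trans by blast
  next
    case (limit \<xi>)
    obtain \<xi>s :: "nat \<Rightarrow> 'a ordinal" where
      "\<And>E. E \<in> S \<xi> \<longleftrightarrow> E = {} \<or> (\<exists>n\<ge>1. (\<forall>x\<in>E. n \<le> x) \<and> E \<in> S (osucc (\<xi>s n)))"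
      using schreier_limit_iff[OF assms(1) limit(1,3)] by metis
    then show ?case by simp
  qed (use assms in \<open>auto simp: schreier_zero\<close>)
  with False assms show ?thesis by simp
qed (use assms in \<open>auto simp: schreier_omega1\<close>)

lemma schreier_singleton:
  assumes "schreier_families S" "\<xi> \<le> omega1" "1 \<le> n"
  shows "{n} \<in> S \<xi>"
proof (cases "\<xi> = omega1")
  case False
  have "\<xi> < omega1 \<Longrightarrow> {n} \<in> S \<xi>"
  proof (induction \<xi> rule: ordinal_induct)
    case (succ \<xi>)
    then show ?case
      using schreier_subset_osucc[OF assms(1)] less_osucc order.strict_trans by blast
  next
    case (limit \<xi>)
    obtain \<xi>s :: "nat \<Rightarrow> 'a ordinal" where \<xi>s:
      "\<And>n. 1 \<le> n \<Longrightarrow> osucc (\<xi>s n) < \<xi>"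
      "\<And>E. E \<in> S \<xi> \<longleftrightarrow> E = {} \<or> (\<exists>n\<ge>1. (\<forall>x\<in>E. n \<le> x) \<and> E \<in> S (osucc (\<xi>s n)))"
      using schreier_limit_iff[OF assms(1) limit(1,3)] by metis
    have "{n} \<in> S (osucc (\<xi>s 1))"
      using limit(2)[of "osucc (\<xi>s 1)"] \<xi>s(1)[of 1] limit(3) by auto
    then show ?case
      unfolding \<xi>s(2) using assms(3) by (intro disjI2 exI[of _ 1]) auto
  qed (use assms in \<open>auto simp: schreier_zero\<close>)
  with False assms show ?thesis by simp
qed (use assms in \<open>auto simp: schreier_omega1\<close>)

text \<open>Closure under moving the elements to the right, by which index sets may be replaced by later ones.\<close>

lemma schreier_spread:
  assumes "schreier_families S" "\<xi> \<le> omega1" "E \<in> S \<xi>"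
    and "strict_mono_on E f" "\<And>n. n \<in> E \<Longrightarrow> n \<le> f n"
  shows "f ` E \<in> S \<xi>"
proof (cases "\<xi> = omega1")
  case True
  then show ?thesis
    using assms by (force simp: schreier_omega1)
next
  case False
  have "\<xi> < omega1 \<Longrightarrow> E \<in> S \<xi> \<Longrightarrow> strict_mono_on E f \<Longrightarrow> (\<forall>n\<in>E. n \<le> f n) \<Longrightarrow> f ` E \<in> S \<xi>" for E
  proof (induction \<xi> arbitrary: E rule: ordinal_induct)
    case zero
    have "card (f ` E) \<le> card E"
      using zero assms(1) by (auto simp: schreier_zero intro: card_image_le)
    with zero assms(1) show ?case
      by (force simp: schreier_zero)
  next
    case (succ \<xi>)
    have lt: "\<xi> < omega1"
      using succ.prems(1) less_osucc order.strict_trans by blast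
    from succ.prems(2) obtain s and Es :: "nat \<Rightarrow> nat set" where
      E: "E = (\<Union>i\<in>{1..s}. Es i)" and
      mem: "\<forall>i\<in>{1..s}. Es i \<noteq> {} \<and> Es i \<in> S \<xi> \<and> (\<forall>x\<in>Es i. s \<le> x)" and
      less: "\<forall>i\<in>{1..<s}. \<forall>x\<in>Es i. \<forall>y\<in>Es (Suc i). x < y"
      unfolding schreier_osucc_iff[OF assms(1) succ.prems(1)] by blast
    have sub: "Es i \<subseteq> E" if "i \<in> {1..s}" for i
      using that E by blast
    have "f ` Es i \<noteq> {} \<and> f ` Es i \<in> S \<xi> \<and> (\<forall>x\<in>f ` Es i. s \<le> x)" if i: "i \<in> {1..s}" for i
    proof -
      have "f ` Es i \<in> S \<xi>"
        using succ.IH[OF lt, of "Es i"] mem i sub[OF i] succ.prems(4)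
          monotone_on_subset[OF succ.prems(3) sub[OF i]] by blast
      moreover have "s \<le> f x" if "x \<in> Es i" for x
        using mem i that sub[OF i] succ.prems(4) by (meson order.trans subsetD)
      ultimately show ?thesis
        using mem i by auto
    qed
    moreover have "x < y" if i: "i \<in> {1..<s}" "x \<in> f ` Es i" "y \<in> f ` Es (Suc i)" for i x y
    proof -
      have "Es i \<subseteq> E" "Es (Suc i) \<subseteq> E"
        using i by (auto intro!: sub)
      with i less succ.prems(3) show ?thesis
        unfolding strict_mono_on_def by blast
    qed
    moreover have "f ` E = (\<Union>i\<in>{1..s}. f ` Es i)"
      using E by blast
    ultimately show ?case
      unfolding schreier_osucc_iff[OF assms(1) succ.prems(1)] by blast
  next
    case (limit \<xi>)
    obtain \<xi>s :: "nat \<Rightarrow> 'a ordinal" where \<xi>s: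
      "\<And>n. 1 \<le> n \<Longrightarrow> osucc (\<xi>s n) < \<xi>"
      "\<And>E. E \<in> S \<xi> \<longleftrightarrow> E = {} \<or> (\<exists>n\<ge>1. (\<forall>x\<in>E. n \<le> x) \<and> E \<in> S (osucc (\<xi>s n)))"
      using schreier_limit_iff[OF assms(1) limit(1,3)] by metis
    show ?case
    proof (cases "E = {}")
      case False
      then obtain n where n: "n \<ge> 1" "\<forall>x\<in>E. n \<le> x" "E \<in> S (osucc (\<xi>s n))"
        using limit.prems(2) \<xi>s(2) by blast
      then have "f ` E \<in> S (osucc (\<xi>s n))"
        using limit.IH[OF \<xi>s(1)[OF n(1)]] limit.prems \<xi>s(1)[OF n(1)] by auto
      moreover have "\<forall>x\<in>f ` E. n \<le> x"
        using n(2) limit.prems(4) order.trans by blast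
      ultimately show ?thesis
        using n(1) \<xi>s(2) by blast
    qed (simp add: \<xi>s(2))
  qed
  with False assms show ?thesis by simp
qed

lemma schreier_spread_dominated:
  fixes f g :: "nat \<Rightarrow> nat"
  assumes "schreier_families S" "\<xi> \<le> omega1" "f ` E \<in> S \<xi>"
    and "strict_mono f" "strict_mono g" "\<And>n. n \<in> E \<Longrightarrow> f n \<le> g n"
  shows "g ` E \<in> S \<xi>"
proof -
  let ?h = "\<lambda>k. g (inv f k)"
  have inv: "inv f (f n) = n" for n
    using strict_mono_imp_inj_on[OF assms(4)] by simp
  have "?h ` f ` E \<in> S \<xi>"
    using assms(1-3)
  proof (rule schreier_spread)
    show "strict_mono_on (f ` E) ?h"
      using assms(4,5) by (auto simp: strict_mono_on_def inv strict_mono_less)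
  qed (use assms(6) in \<open>auto simp: inv\<close>)
  then show ?thesis
    by (simp add: image_image inv)
qed

text \<open>
  The families are increasing only up to finitely many integers: at a limit \<open>\<xi>\<close> the members of
  \<open>S (\<xi>\<^sub>n + 1)\<close> enter \<open>S \<xi>\<close> once their minimum is at least \<open>n\<close>.
\<close>

lemma schreier_almost_mono:
  assumes "schreier_families S" "\<eta> \<le> \<xi>" "\<xi> \<le> omega1"
  shows "\<exists>k. \<forall>E\<in>S \<eta>. (\<forall>n\<in>E. k \<le> n) \<longrightarrow> E \<in> S \<xi>"
proof (cases "\<xi> = omega1")
  case True
  then show ?thesis
    using schreier_finite[OF assms(1), of \<eta>] assms by (auto simp: schreier_omega1)
next
  case False
  have "\<xi> < omega1 \<Longrightarrow> \<eta> \<le> \<xi> \<Longrightarrow> \<exists>k. \<forall>E\<in>S \<eta>. (\<forall>n\<in>E. k \<le> n) \<longrightarrow> E \<in> S \<xi>"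
  proof (induction \<xi> rule: ordinal_induct)
    case zero
    then show ?case using zero_le_ordinal[of \<eta>] by auto
  next
    case (succ \<xi>)
    show ?case
    proof (cases "\<eta> = osucc \<xi>")
      case False
      then have "\<eta> \<le> \<xi>"
        using succ.prems(2) by (simp add: le_osucc_iff)
      moreover have "\<xi> < omega1"
        using less_osucc succ.prems(1) by (rule order.strict_trans)
      ultimately have "\<exists>k. \<forall>E\<in>S \<eta>. (\<forall>n\<in>E. k \<le> n) \<longrightarrow> E \<in> S \<xi>"
        using succ.IH by blast
      then show ?thesis
        using schreier_subset_osucc[OF assms(1) succ.prems(1)] by blast
    qed auto
  next
    case (limit \<xi>)
    obtain \<xi>s :: "nat \<Rightarrow> 'a ordinal" where \<xi>s:
      "\<And>n. 1 \<le> n \<Longrightarrow> osucc (\<xi>s n) < \<xi>" "\<And>\<zeta>. \<zeta> < \<xi> \<Longrightarrow> \<exists>n\<ge>1. \<zeta> \<le> osucc (\<xi>s n)"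
      "\<And>E. E \<in> S \<xi> \<longleftrightarrow> E = {} \<or> (\<exists>n\<ge>1. (\<forall>x\<in>E. n \<le> x) \<and> E \<in> S (osucc (\<xi>s n)))"
      using schreier_limit_iff[OF assms(1) limit(1,3)] by metis
    show ?case
    proof (cases "\<eta> = \<xi>")
      case False
      with limit.prems(2) have "\<eta> < \<xi>"
        by (simp add: order.strict_iff_order)
      then obtain n where n: "n \<ge> 1" "\<eta> \<le> osucc (\<xi>s n)"
        using \<xi>s(2) by blast
      have "osucc (\<xi>s n) < omega1"
        using \<xi>s(1)[OF n(1)] limit.prems(1) by (rule order.strict_trans)
      then obtain k where k: "\<forall>E\<in>S \<eta>. (\<forall>m\<in>E. k \<le> m) \<longrightarrow> E \<in> S (osucc (\<xi>s n))"
        using limit.IH[OF \<xi>s(1)[OF n(1)]] n(2) by blast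
      then have "\<forall>E\<in>S \<eta>. (\<forall>m\<in>E. max k n \<le> m) \<longrightarrow> E \<in> S \<xi>"
        unfolding \<xi>s(3) using n(1) by (metis max.bounded_iff)
      then show ?thesis by blast
    qed auto
  qed
  with False assms show ?thesis by simp
qed

text \<open>
  The condition \<open>i \<le> x\<close> makes the minima of the blocks a spread of their indices, so it suffices
  to know that the set of indices \<open>A\<close> belongs to a Schreier family.
\<close>

definition successive_blocks :: "nat set set \<Rightarrow> nat set \<Rightarrow> (nat \<Rightarrow> nat set) \<Rightarrow> bool" where
  "successive_blocks F A E \<longleftrightarrow>
     (\<forall>i\<in>A. E i \<noteq> {} \<and> E i \<in> F \<and> (\<forall>x\<in>E i. i \<le> x)) \<and>
     (\<forall>i\<in>A. \<forall>j\<in>A. i < j \<longrightarrow> (\<forall>x\<in>E i. \<forall>y\<in>E j. x < y))"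

lemma successive_blocks_subset:
  "successive_blocks F A E \<Longrightarrow> B \<subseteq> A \<Longrightarrow> successive_blocks F B E"
  unfolding successive_blocks_def by blast

text \<open>
  Up to a subsequence, \<open>S \<zeta> [S \<xi>] \<subseteq> S (\<xi> + \<zeta>)\<close>.  The induction on \<open>\<zeta>\<close> needs a new subsequence
  only at limits, where countably many have to be combined; as the families are closed under
  moving elements to the right, a sequence which dominates the first \<open>i\<close> of them at \<open>i\<close> will do,
  and no diagonal subsequence is required.
\<close>

lemma schreier_sum:
  assumes S: "schreier_families S"
  shows "\<xi> + \<zeta> < omega1 \<Longrightarrow> \<exists>m. strict_mono m \<and>
    (\<forall>A\<in>S \<zeta>. \<forall>E. successive_blocks (S \<xi>) A E \<longrightarrow> m ` (\<Union>i\<in>A. E i) \<in> S (\<xi> + \<zeta>))"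
proof (induction \<zeta> rule: ordinal_induct)
  case zero
  have "id ` (\<Union>i\<in>A. E i) \<in> S (\<xi> + 0)" if A: "A \<in> S 0" "successive_blocks (S \<xi>) A E" for A E
  proof (cases "A = {}")
    case True
    then show ?thesis
      using schreier_empty[OF S, of \<xi>] zero by simp
  next
    case False
    then obtain i where "A = {i}"
      using A(1) by (auto simp: schreier_zero[OF S] le_Suc_eq card_1_singleton_iff)
    then show ?thesis
      using A(2) by (simp add: successive_blocks_def)
  qed
  then show ?case
    using strict_mono_id by blast
next
  case (succ \<zeta>)
  let ?\<rho> = "\<xi> + \<zeta>"
  have lt: "osucc ?\<rho> < omega1" "?\<rho> < omega1"
    using succ.prems less_osucc[of ?\<rho>] by auto
  have lt\<zeta>: "osucc \<zeta> < omega1"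
    using succ.prems le_add_right_ordinal[of "osucc \<zeta>" \<xi>] by simp
  obtain m where m: "strict_mono m"
    "\<And>A E. A \<in> S \<zeta> \<Longrightarrow> successive_blocks (S \<xi>) A E \<Longrightarrow> m ` (\<Union>i\<in>A. E i) \<in> S ?\<rho>"
    using succ.IH[OF lt(2)] by blast
  have "m ` (\<Union>i\<in>A. E i) \<in> S (osucc ?\<rho>)"
    if A: "A \<in> S (osucc \<zeta>)" and E: "successive_blocks (S \<xi>) A E" for A E
  proof -
    from A obtain s and As :: "nat \<Rightarrow> nat set" where
      A_eq: "A = (\<Union>j\<in>{1..s}. As j)" and
      mem: "\<forall>j\<in>{1..s}. As j \<noteq> {} \<and> As j \<in> S \<zeta> \<and> (\<forall>x\<in>As j. s \<le> x)" and
      less: "\<forall>j\<in>{1..<s}. \<forall>x\<in>As j. \<forall>y\<in>As (Suc j). x < y"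
      unfolding schreier_osucc_iff[OF S lt\<zeta>] by blast
    let ?G = "\<lambda>j. m ` (\<Union>i\<in>As j. E i)"
    have sub: "As j \<subseteq> A" if "j \<in> {1..s}" for j
      using that A_eq by blast
    have "?G j \<noteq> {} \<and> ?G j \<in> S ?\<rho> \<and> (\<forall>x\<in>?G j. s \<le> x)" if j: "j \<in> {1..s}" for j
    proof -
      have E': "successive_blocks (S \<xi>) (As j) E"
        using E sub[OF j] by (rule successive_blocks_subset)
      have "s \<le> m x" if "i \<in> As j" "x \<in> E i" for i x
      proof -
        have "s \<le> i" using mem j that by blast
        also have "i \<le> x" using E' that by (auto simp: successive_blocks_def)
        also have "x \<le> m x" using m(1) by (rule strict_mono_imp_increasing)
        finally show ?thesis .
      qed
      moreover have "(\<Union>i\<in>As j. E i) \<noteq> {}"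
        using mem j E' by (fastforce simp: successive_blocks_def)
      ultimately show ?thesis
        using m(2)[OF _ E'] mem j by blast
    qed
    moreover have "x < y" if j: "j \<in> {1..<s}" "x \<in> ?G j" "y \<in> ?G (Suc j)" for j x y
    proof -
      obtain i i' u v where iv: "i \<in> As j" "i' \<in> As (Suc j)" "u \<in> E i" "v \<in> E i'" "x = m u" "y = m v"
        using j(2,3) by blast
      have "i < i'" using less j(1) iv by blast
      moreover have "i \<in> A" "i' \<in> A"
        using iv sub[of j] sub[of "Suc j"] j(1) by auto
      ultimately have "u < v"
        using E iv unfolding successive_blocks_def by blast
      then show ?thesis
        using m(1) iv by (simp add: strict_mono_less)
    qed
    moreover have "m ` (\<Union>i\<in>A. E i) = (\<Union>j\<in>{1..s}. ?G j)"
      unfolding A_eq by blast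
    ultimately show ?thesis
      unfolding schreier_osucc_iff[OF S lt(1)] by (intro exI[of _ s] exI[of _ ?G]) blast
  qed
  with m(1) show ?case by auto
next
  case (limit \<zeta>)
  let ?\<rho> = "\<xi> + \<zeta>"
  have "\<zeta> < omega1"
    using limit.prems le_add_right_ordinal[of \<zeta> \<xi>] by simp
  then obtain \<zeta>s :: "nat \<Rightarrow> 'a ordinal" where \<zeta>s:
    "\<And>n. 1 \<le> n \<Longrightarrow> osucc (\<zeta>s n) < \<zeta>"
    "\<And>E. E \<in> S \<zeta> \<longleftrightarrow> E = {} \<or> (\<exists>n\<ge>1. (\<forall>x\<in>E. n \<le> x) \<and> E \<in> S (osucc (\<zeta>s n)))"
    using schreier_limit_iff[OF S limit(1)] by metis
  let ?\<rho>n = "\<lambda>n. \<xi> + osucc (\<zeta>s n)"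
  have le: "?\<rho>n n \<le> ?\<rho>" if "1 \<le> n" for n
    using \<zeta>s(1)[OF that] by (intro add_left_mono_ordinal) simp
  have "\<exists>m k. strict_mono m \<and>
    (\<forall>A\<in>S (osucc (\<zeta>s n)). \<forall>E. successive_blocks (S \<xi>) A E \<longrightarrow> m ` (\<Union>i\<in>A. E i) \<in> S (?\<rho>n n)) \<and>
    (\<forall>E\<in>S (?\<rho>n n). (\<forall>x\<in>E. k \<le> x) \<longrightarrow> E \<in> S ?\<rho>)" if n: "1 \<le> n" for n
  proof -
    have "?\<rho>n n < omega1"
      using le[OF n] limit.prems by (rule order.strict_trans1)
    then obtain m where "strict_mono m"
      "\<forall>A\<in>S (osucc (\<zeta>s n)). \<forall>E. successive_blocks (S \<xi>) A E \<longrightarrow> m ` (\<Union>i\<in>A. E i) \<in> S (?\<rho>n n)"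
      using limit.IH[OF \<zeta>s(1)[OF n]] by blast
    moreover obtain k where "\<forall>E\<in>S (?\<rho>n n). (\<forall>x\<in>E. k \<le> x) \<longrightarrow> E \<in> S ?\<rho>"
      using schreier_almost_mono[OF S le[OF n] order.strict_implies_order[OF limit.prems]] by blast
    ultimately show ?thesis by blast
  qed
  then obtain m :: "nat \<Rightarrow> nat \<Rightarrow> nat" and k :: "nat \<Rightarrow> nat" where
    m: "\<And>n. 1 \<le> n \<Longrightarrow> strict_mono (m n)" and
    mA: "\<And>n A E. 1 \<le> n \<Longrightarrow> A \<in> S (osucc (\<zeta>s n)) \<Longrightarrow> successive_blocks (S \<xi>) A E \<Longrightarrow>
      m n ` (\<Union>i\<in>A. E i) \<in> S (?\<rho>n n)" and
    k: "\<And>n E. 1 \<le> n \<Longrightarrow> E \<in> S (?\<rho>n n) \<Longrightarrow> (\<forall>x\<in>E. k n \<le> x) \<Longrightarrow> E \<in> S ?\<rho>"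
    by metis
  \<comment> \<open>The \<open>i\<close>-th value dominates \<open>m n i\<close> and \<open>k n\<close> for all \<open>n \<le> i\<close>, which suffices because a set
    with index \<open>n\<close> has no element below \<open>n\<close>.\<close>
  define M where "M = (\<lambda>i. (\<Sum>n\<in>{1..i}. m n i + k n) + i)"
  have "(\<Sum>n\<in>{1..i}. m n i + k n) \<le> (\<Sum>n\<in>{1..j}. m n j + k n)" if "i < j" for i j
  proof -
    have "(\<Sum>n\<in>{1..i}. m n i + k n) \<le> (\<Sum>n\<in>{1..i}. m n j + k n)"
      using m that by (intro sum_mono) (simp add: strict_mono_less_eq)
    also have "\<dots> \<le> (\<Sum>n\<in>{1..j}. m n j + k n)"
      using that by (intro sum_mono2) auto
    finally show ?thesis .
  qed
  then have M: "strict_mono M"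
    unfolding M_def by (intro strict_monoI) (simp add: add_le_less_mono)
  have dom: "m n i + k n \<le> M i" if "1 \<le> n" "n \<le> i" for n i
    using member_le_sum[of n "{1..i}" "\<lambda>n. m n i + k n"] that unfolding M_def by auto
  have "M ` (\<Union>i\<in>A. E i) \<in> S ?\<rho>" if A: "A \<in> S \<zeta>" and E: "successive_blocks (S \<xi>) A E" for A E
  proof (cases "A = {}")
    case True
    then show ?thesis
      using schreier_empty[OF S order.strict_implies_order[OF limit.prems]] by simp
  next
    case False
    then obtain n where n: "n \<ge> 1" "\<forall>x\<in>A. n \<le> x" "A \<in> S (osucc (\<zeta>s n))"
      using A \<zeta>s(2) by blast
    have ge: "n \<le> x" if "x \<in> (\<Union>i\<in>A. E i)" for x
      using E n(2) that unfolding successive_blocks_def by (meson UN_E order.trans)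
    have "M ` (\<Union>i\<in>A. E i) \<in> S (?\<rho>n n)"
      using S _ mA[OF n(1,3) E] m[OF n(1)] M
    proof (rule schreier_spread_dominated)
      show "?\<rho>n n \<le> omega1"
        using le[OF n(1)] limit.prems by (meson order.strict_implies_order order.trans)
      show "m n x \<le> M x" if "x \<in> (\<Union>i\<in>A. E i)" for x
        using dom[OF n(1) ge[OF that]] by simp
    qed
    moreover have "k n \<le> M x" if "x \<in> (\<Union>i\<in>A. E i)" for x
      using dom[OF n(1) ge[OF that]] by simp
    ultimately show ?thesis
      using k[OF n(1)] by blast
  qed
  with M show ?case by blast
qed


section \<open>Norms on coefficient lists\<close>

lemma lp_norm_Nil [simp]: "lp_norm p [] = 0"
  by (simp add: lp_norm_def)

lemma lp_norm_infinity_eq_1_iff: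
  "lp_norm \<infinity> as = 1 \<longleftrightarrow> (\<forall>a\<in>set as. norm a \<le> 1) \<and> (\<exists>a\<in>set as. norm a = 1)"
proof -
  have "lp_norm \<infinity> as = 1 \<longleftrightarrow> 1 \<in> insert 0 (norm ` set as) \<and> (\<forall>r\<in>insert 0 (norm ` set as). r \<le> 1)"
    unfolding lp_norm_def if_P[OF refl] by (subst Max_eq_iff) auto
  then show ?thesis by force
qed

lemma lp_norm_finite_eq_1_iff:
  assumes "1 \<le> p" "p \<noteq> \<infinity>"
  shows "lp_norm p as = 1 \<longleftrightarrow> (\<Sum>a\<leftarrow>as. norm a powr enn2real p) = 1"
proof -
  let ?s = "\<Sum>a\<leftarrow>as. norm a powr enn2real p"
  have pos: "enn2real p \<noteq> 0"
    using assms by (auto simp: enn2real_eq_0_iff)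
  have "?s \<ge> 0"
    by (intro sum_list_nonneg) auto
  moreover have "?s powr (1 / enn2real p) = 1 \<Longrightarrow> ?s \<noteq> 0 \<Longrightarrow> ?s = 1"
  proof -
    assume "?s powr (1 / enn2real p) = 1" "?s \<noteq> 0"
    then have "(?s powr (1 / enn2real p)) powr enn2real p = 1" by simp
    then show "?s = 1"
      using pos \<open>?s \<ge> 0\<close> by (simp add: powr_powr)
  qed
  ultimately show ?thesis
    using assms(2) by (cases "?s = 0") (auto simp: lp_norm_def)
qed

lemma lp_norm_eq_1_imp_norm_le_1:
  assumes "1 \<le> p" "lp_norm p as = 1" "a \<in> set as"
  shows "norm a \<le> 1"
proof (cases "p = \<infinity>")
  case True
  show ?thesis using assms(2,3) unfolding True lp_norm_infinity_eq_1_iff by blast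
next
  case False
  let ?q = "enn2real p"
  have "norm a powr ?q \<le> (\<Sum>a\<leftarrow>as. norm a powr ?q)"
    using assms(3) by (intro member_le_sum_list) auto
  also have "\<dots> = 1"
    by (rule iffD1[OF lp_norm_finite_eq_1_iff[OF assms(1) False] assms(2)])
  finally have "norm a powr ?q \<le> 1" .
  moreover have "0 < ?q"
    using assms(1) False order.strict_trans2[OF zero_less_one assms(1)]
    by (simp add: enn2real_positive_iff less_top)
  ultimately show ?thesis
    using gr_one_powr[of "norm a" ?q] by linarith
qed

lemma lp_norm_unit:
  assumes "1 \<le> p"
  shows "lp_norm p (replicate m 0 @ 1 # replicate n (0 :: 'k :: real_normed_field)) = 1"
proof (cases "p = \<infinity>")
  case True
  show ?thesis unfolding True lp_norm_infinity_eq_1_iff by auto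
next
  case False
  then show ?thesis
    using assms by (simp add: lp_norm_finite_eq_1_iff sum_list_replicate)
qed

lemma lp_norm_map_norm: "lp_norm p (map norm as) = lp_norm p as"
  by (simp add: lp_norm_def image_image o_def)

lemma lp_norm_one: "lp_norm 1 as = (\<Sum>a\<leftarrow>as. norm a)"
proof -
  have "(\<Sum>a\<leftarrow>as. norm a) \<ge> 0"
    by (intro sum_list_nonneg) auto
  then show ?thesis
    by (simp add: lp_norm_def)
qed

text \<open>
  Replacing every coordinate of a unit vector of \<open>\<ell>\<^sub>p\<close> by its product with a unit vector of
  \<open>\<ell>\<^sub>p\<close> yields a unit vector: an \<open>\<ell>\<^sub>p\<close>-sum of copies of \<open>\<ell>\<^sub>p\<close> is \<open>\<ell>\<^sub>p\<close>.  This is what makes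
  normalized blocks of an \<open>\<ell>\<^sub>p\<close> system an \<open>\<ell>\<^sub>p\<close> system again.
\<close>

lemma lp_norm_blocks:
  fixes bs :: "'k :: real_normed_field list"
  assumes p: "1 \<le> p" and len: "length bs = length js"
    and unit: "\<And>j. j \<in> set js \<Longrightarrow> lp_norm p (a j) = 1" and bs: "lp_norm p bs = 1"
  shows "lp_norm p (concat (map (\<lambda>(b, j). map ((*) b) (a j)) (zip bs js))) = 1"
proof (cases "p = \<infinity>")
  case True
  have a: "\<And>j c. j \<in> set js \<Longrightarrow> c \<in> set (a j) \<Longrightarrow> norm c \<le> 1"
    "\<And>j. j \<in> set js \<Longrightarrow> \<exists>c\<in>set (a j). norm c = 1"
    using unit unfolding True lp_norm_infinity_eq_1_iff by blast+
  have b: "\<And>c. c \<in> set bs \<Longrightarrow> norm c \<le> 1" "\<exists>c\<in>set bs. norm c = 1"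
    using bs unfolding True lp_norm_infinity_eq_1_iff by blast+
  obtain i where i: "i < length bs" "norm (bs ! i) = 1"
    using b(2) by (metis in_set_conv_nth)
  then obtain c where c: "c \<in> set (a (js ! i))" "norm c = 1"
    using a(2)[of "js ! i"] len by auto
  have "(bs ! i, js ! i) \<in> set (zip bs js)"
    using i len by (auto simp: set_zip)
  moreover have "norm (bs ! i * c) = 1"
    using i c by (simp add: norm_mult)
  ultimately have "\<exists>d\<in>set (concat (map (\<lambda>(b, j). map ((*) b) (a j)) (zip bs js))). norm d = 1"
    using c(1) by force
  moreover have "norm d \<le> 1"
    if d: "d \<in> set (concat (map (\<lambda>(b, j). map ((*) b) (a j)) (zip bs js)))" for d
  proof -
    obtain b j c where "(b, j) \<in> set (zip bs js)" "c \<in> set (a j)" "d = b * c"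
      using d by auto
    then show ?thesis
      using a(1)[of j c] b(1)[of b] by (auto simp: norm_mult dest: set_zip_leftD set_zip_rightD intro!: mult_le_one)
  qed
  ultimately show ?thesis
    unfolding True lp_norm_infinity_eq_1_iff by blast
next
  case False
  let ?q = "enn2real p"
  note iff = lp_norm_finite_eq_1_iff[OF p False]
  have "(\<Sum>c\<leftarrow>concat (map (\<lambda>(b, j). map ((*) b) (a j)) (zip bs js)). norm c powr ?q)
      = (\<Sum>b\<leftarrow>bs. norm b powr ?q)"
    using len unit
  proof (induction bs js rule: list_induct2)
    case (Cons b bs j js)
    have "(\<Sum>c\<leftarrow>map ((*) b) (a j). norm c powr ?q) = norm b powr ?q * (\<Sum>c\<leftarrow>a j. norm c powr ?q)"
      by (simp add: o_def norm_mult powr_mult sum_list_const_mult)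
    also have "(\<Sum>c\<leftarrow>a j. norm c powr ?q) = 1"
      using Cons.prems[of j] by (simp add: iff)
    finally show ?case
      using Cons by simp
  qed simp
  then show ?thesis
    using bs by (simp add: iff)
qed

text \<open>
  The weights \<open>\<epsilon>\<close> have norm at most \<open>\<delta>\<close> in \<open>\<ell>\<^sub>q\<close>, the dual of \<open>\<ell>\<^sub>p\<close>: errors of size \<open>\<epsilon> i\<close> in the
  \<open>i\<close>-th vector then change linear combinations with unit coefficients by at most \<open>\<delta>\<close>.  For
  \<open>p = 1\<close> constant weights are admissible, for other \<open>p\<close> summable ones are.  Only the moduli of
  coefficients matter, so real coefficients represent those from any scalar field.
\<close>

definition dual_bound :: "ennreal \<Rightarrow> (nat \<Rightarrow> real) \<Rightarrow> real \<Rightarrow> bool" where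
  "dual_bound p \<epsilon> \<delta> \<longleftrightarrow>
     (\<forall>js (rs :: real list). distinct js \<and> length rs = length js \<and> lp_norm p rs = 1 \<longrightarrow>
        (\<Sum>(r, j)\<leftarrow>zip rs js. \<bar>r\<bar> * \<epsilon> j) \<le> \<delta>)"

lemma dual_boundD:
  assumes "dual_bound p \<epsilon> \<delta>" "distinct js" "length bs = length js" "lp_norm p bs = 1"
  shows "(\<Sum>(b, j)\<leftarrow>zip bs js. norm b * \<epsilon> j) \<le> \<delta>"
proof -
  have "(\<Sum>(r, j)\<leftarrow>zip (map norm bs) js. \<bar>r\<bar> * \<epsilon> j) \<le> \<delta>"
    using assms unfolding dual_bound_def by (simp add: lp_norm_map_norm)
  then show ?thesis
    by (simp add: zip_map1 o_def case_prod_unfold)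
qed

lemma dual_bound_one: "dual_bound 1 (\<lambda>_. \<delta>) \<delta>"
proof -
  have "(\<Sum>(r, j)\<leftarrow>zip rs js. \<bar>r\<bar> * \<delta>) = (\<Sum>r\<leftarrow>rs. \<bar>r\<bar>) * \<delta>"
    if "length rs = length js" for rs :: "real list" and js :: "nat list"
    using that by (induction rs js rule: list_induct2) (auto simp: algebra_simps)
  then show ?thesis
    by (simp add: dual_bound_def lp_norm_one)
qed

lemma dual_bound_geometric:
  assumes "1 \<le> p" "0 \<le> \<delta>"
  shows "dual_bound p (\<lambda>j. \<delta> * (1 / 2) ^ Suc j) \<delta>"
  unfolding dual_bound_def
proof (intro allI impI, elim conjE)
  fix js :: "nat list" and rs :: "real list"
  assume js: "distinct js" "length rs = length js" "lp_norm p rs = 1"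
  let ?\<epsilon> = "\<lambda>j. \<delta> * (1 / 2) ^ Suc j"
  have sums: "?\<epsilon> sums \<delta>"
    using sums_mult[OF power_half_series, of \<delta>] by simp
  have "(\<Sum>(r, j)\<leftarrow>zip rs js. \<bar>r\<bar> * ?\<epsilon> j) \<le> (\<Sum>(r, j)\<leftarrow>zip rs js. ?\<epsilon> j)"
  proof (rule sum_list_mono, clarify)
    fix r j assume "(r, j) \<in> set (zip rs js)"
    then have "norm r \<le> 1"
      using lp_norm_eq_1_imp_norm_le_1[OF assms(1) js(3)] by (auto dest: set_zip_leftD)
    then show "\<bar>r\<bar> * ?\<epsilon> j \<le> ?\<epsilon> j"
      using assms(2) by (intro mult_left_le_one_le) auto
  qed
  also have "\<dots> = (\<Sum>j\<leftarrow>js. ?\<epsilon> j)"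
    using js(2) by (induction rs js rule: list_induct2) auto
  also have "\<dots> = (\<Sum>j\<in>set js. ?\<epsilon> j)"
    using js(1) by (rule sum_list_distinct_conv_sum_set)
  also have "\<dots> \<le> (\<Sum>j. ?\<epsilon> j)"
    using assms(2) by (intro sum_le_suminf sums_summable[OF sums]) auto
  also have "\<dots> = \<delta>"
    using sums by (rule sums_unique[symmetric])
  finally show "(\<Sum>(r, j)\<leftarrow>zip rs js. \<bar>r\<bar> * ?\<epsilon> j) \<le> \<delta>" .
qed

lemma perturbation_constant:
  fixes K C :: real
  assumes "1 \<le> K" "K < C"
  obtains \<delta> :: real where "0 < \<delta>" "\<delta> \<le> 1" "(1 + \<delta>) / C \<le> 1 / K - \<delta>"
proof -
  define a b where "a = 1 / K" and "b = 1 / C"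
  have le: "b < a" "a \<le> 1" "0 < b"
    using assms by (auto simp: a_def b_def field_simps)
  define \<delta> where "\<delta> = (a - b) / 2"
  have \<delta>: "0 < \<delta>" "\<delta> \<le> 1" "b + \<delta> = a - \<delta>"
    using le by (auto simp: \<delta>_def field_simps)
  have "(1 + \<delta>) * b = b + \<delta> * b"
    by (simp add: algebra_simps)
  also have "\<dots> \<le> b + \<delta> * 1"
    using le \<delta>(1) by (intro add_mono mult_left_mono) auto
  finally have "(1 + \<delta>) / C \<le> 1 / K - \<delta>"
    using \<delta>(3) by (simp add: a_def b_def)
  with \<delta>(1,2) show thesis
    by (rule that)
qed


section \<open>Linear combinations in the space, the subspace and the quotient\<close>

locale normed_subspace =
  fixes scl :: "'k::{real_normed_field, euclidean_space} \<Rightarrow> 'a::real_normed_vector \<Rightarrow> 'a"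
    and Y :: "'a set"
  assumes scalar_mult: "scalar_mult scl"
    and subspace: "module.subspace scl Y"
begin

sublocale vector_space scl
  using scalar_mult by (simp add: scalar_mult_def)

lemma norm_scl [simp]: "norm (scl c x) = norm c * norm x"
  using scalar_mult by (simp add: scalar_mult_def)

lemma Y_zero: "0 \<in> Y" and Y_add: "x \<in> Y \<Longrightarrow> y \<in> Y \<Longrightarrow> x + y \<in> Y" and Y_scl: "y \<in> Y \<Longrightarrow> scl c y \<in> Y"
  using subspace subspace_def by auto

definition lin :: "'k list \<Rightarrow> 'a list \<Rightarrow> 'a" where
  "lin as xs = (\<Sum>(a, x)\<leftarrow>zip as xs. scl a x)"

lemma lin_Nil [simp]: "lin [] xs = 0" "lin as [] = 0"
  and lin_Cons [simp]: "lin (a # as) (x # xs) = scl a x + lin as xs"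
  by (simp_all add: lin_def)

lemma lin_append: "length as = length xs \<Longrightarrow> lin (as @ bs) (xs @ ys) = lin as xs + lin bs ys"
  by (simp add: lin_def)

lemma lin_replicate_zero: "lin (replicate n 0) xs = 0"
proof (induction xs arbitrary: n)
  case (Cons x xs)
  then show ?case by (cases n) auto
qed simp

lemma lin_unit:
  assumes "x \<in> set xs"
  obtains m n where "length (replicate m 0 @ 1 # replicate n 0) = length xs"
    "lin (replicate m 0 @ 1 # replicate n 0) xs = x"
proof -
  obtain us vs where "xs = us @ x # vs"
    using assms by (metis split_list)
  then show thesis
    by (intro that[of "length us" "length vs"]) (simp_all add: lin_append lin_replicate_zero)
qed

lemma lin_map_mult: "lin (map ((*) b) as) xs = scl b (lin as xs)"
proof (induction as arbitrary: xs)
  case (Cons a as)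
  then show ?case by (cases xs) (auto simp: scale_right_distrib)
qed simp

lemma lin_map_scl: "lin as (map (\<lambda>j. scl c (f j)) js) = scl c (lin as (map f js))"
proof (induction as arbitrary: js)
  case (Cons a as)
  then show ?case
    by (cases js) (auto simp: scale_right_distrib scale_left_commute)
qed simp

lemma lin_concat:
  assumes "length bs = length js" "\<And>j. j \<in> set js \<Longrightarrow> length (a j) = length (t j)"
  shows "lin (concat (map (\<lambda>(b, j). map ((*) b) (a j)) (zip bs js))) (concat (map t js))
    = lin bs (map (\<lambda>j. lin (a j) (t j)) js)"
  using assms by (induction bs js rule: list_induct2) (auto simp: lin_append lin_map_mult)

lemma lin_map_sum:
  "distinct js \<Longrightarrow> lin (map c js) (map v js) = (\<Sum>j\<in>set js. scl (c j) (v j))"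
  by (induction js) auto

lemma norm_lin_diff_le:
  assumes "length bs = length js" "\<And>j. j \<in> set js \<Longrightarrow> norm (z j - y j) \<le> \<epsilon> j"
  shows "norm (lin bs (map z js) - lin bs (map y js)) \<le> (\<Sum>(b, j)\<leftarrow>zip bs js. norm b * \<epsilon> j)"
  using assms
proof (induction bs js rule: list_induct2)
  case (Cons b bs j js)
  have "norm (lin (b # bs) (map z (j # js)) - lin (b # bs) (map y (j # js)))
      = norm (scl b (z j - y j) + (lin bs (map z js) - lin bs (map y js)))"
    by (simp add: scale_right_diff_distrib algebra_simps)
  also have "\<dots> \<le> norm b * norm (z j - y j) + norm (lin bs (map z js) - lin bs (map y js))"
    by (metis norm_scl norm_triangle_ineq)
  also have "\<dots> \<le> norm b * \<epsilon> j + (\<Sum>(b, j)\<leftarrow>zip bs js. norm b * \<epsilon> j)"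
    using Cons by (intro add_mono mult_left_mono) auto
  finally show ?case by simp
qed simp

lemma lincomb_subspace [simp]: "lincomb (subspace_of scl Z) as xs = lin as xs"
proof -
  have "foldr (\<lambda>(a, x) s. scl a x + s) zs 0 = (\<Sum>(a, x)\<leftarrow>zs. scl a x)" for zs
    by (induction zs) auto
  then show ?thesis
    by (simp add: lincomb_def lin_def subspace_of_def)
qed

lemma points_subspace [simp]: "points (subspace_of scl Z) = Z"
  and nrm_subspace [simp]: "nrm (subspace_of scl Z) = norm"
  by (simp_all add: subspace_of_def)

text \<open>The condition that the vectors lie in the unit ball is the case of a unit coefficient vector.\<close>

lemma T_tree_subspace_iff:
  assumes "1 \<le> p"
  shows "xs \<in> T_tree p (subspace_of scl Z) K \<longleftrightarrow> set xs \<subseteq> Z \<and>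
    (\<forall>as. length as = length xs \<and> lp_norm p as = 1 \<longrightarrow> 1 / K \<le> norm (lin as xs) \<and> norm (lin as xs) \<le> 1)"
proof -
  have "norm x \<le> 1" if "\<forall>as. length as = length xs \<and> lp_norm p as = 1 \<longrightarrow> norm (lin as xs) \<le> 1"
    "x \<in> set xs" for x
    using lin_unit[OF that(2)] that(1) lp_norm_unit[OF assms] by metis
  then show ?thesis
    by (auto simp: T_tree_def)
qed

definition coset :: "'a \<Rightarrow> 'a set" where
  "coset x = {x + y | y. y \<in> Y}"

lemma add_coset: "add (quotient_by scl Y) (coset x) (coset y) = coset (x + y)"
proof -
  have "x + y + v \<in> {a + b | a b. a \<in> coset x \<and> b \<in> coset y}" if "v \<in> Y" for v
    using that Y_zero unfolding coset_def
    by (intro CollectI exI[of _ "x + v"] exI[of _ "y + 0"]) (force simp: algebra_simps)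
  moreover have "(x + u) + (y + v) \<in> coset (x + y)" if "u \<in> Y" "v \<in> Y" for u v
    using Y_add[OF that] unfolding coset_def by (force simp: algebra_simps)
  ultimately have "{a + b | a b. a \<in> coset x \<and> b \<in> coset y} = coset (x + y)"
    unfolding coset_def by blast
  then show ?thesis
    by (simp add: quotient_by_def)
qed

lemma scale_coset: "scale (quotient_by scl Y) c (coset x) = coset (scl c x)"
proof -
  have "scl c (x + u) + v \<in> coset (scl c x)" if "u \<in> Y" "v \<in> Y" for u v
    using Y_add[OF Y_scl[OF that(1), of c] that(2)] unfolding coset_def
    by (force simp: scale_right_distrib algebra_simps)
  moreover have "scl c x + v \<in> {scl c a + y | a y. a \<in> coset x \<and> y \<in> Y}" if "v \<in> Y" for v
    using that Y_zero unfolding coset_def by (intro CollectI exI[of _ "x + 0"] exI[of _ v]) force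
  ultimately have "{scl c a + y | a y. a \<in> coset x \<and> y \<in> Y} = coset (scl c x)"
    unfolding coset_def by blast
  then show ?thesis
    by (simp add: quotient_by_def)
qed

lemma zer_quotient: "zer (quotient_by scl Y) = coset 0"
  by (simp add: quotient_by_def coset_def)

lemma lincomb_quotient: "lincomb (quotient_by scl Y) as (map coset xs) = coset (lin as xs)"
proof -
  have "foldr (\<lambda>(a, A) s. add (quotient_by scl Y) (scale (quotient_by scl Y) a A) s)
      (zip as (map coset xs)) (zer (quotient_by scl Y)) = coset (lin as xs)"
  proof (induction as arbitrary: xs)
    case Nil
    show ?case by (simp add: zer_quotient)
  next
    case (Cons a as)
    show ?case
    proof (cases xs)
      case Nil
      then show ?thesis by (simp add: zer_quotient)
    next
      case (Cons x xs')
      then show ?thesis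
        using Cons.IH[of xs'] by (simp add: scale_coset add_coset)
    qed
  qed
  then show ?thesis
    by (simp add: lincomb_def)
qed

lemma nrm_quotient: "nrm (quotient_by scl Y) (coset x) = infdist x Y"
proof -
  have "coset x = (\<lambda>y. x - y) ` Y"
  proof -
    have neg: "- y \<in> Y" if "y \<in> Y" for y
      using Y_scl[OF that, of "- 1"] by simp
    have "x + y \<in> (\<lambda>y. x - y) ` Y" if "y \<in> Y" for y
      using neg[OF that] by (intro image_eqI[of _ _ "- y"]) auto
    moreover have "x - y \<in> coset x" if "y \<in> Y" for y
      using neg[OF that] unfolding coset_def by force
    ultimately show ?thesis
      unfolding coset_def by blast
  qed
  then show ?thesis
    using Y_zero by (auto simp: quotient_by_def infdist_def dist_norm image_image)
qed

lemma infdist_less_witness: "infdist x Y < e \<Longrightarrow> \<exists>y\<in>Y. norm (x - y) < e"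
  using Y_zero cInf_lessD[of "dist x ` Y" e] by (auto simp: infdist_def dist_norm split: if_splits)

lemma infdist_le_norm: "infdist x Y \<le> norm x"
  using infdist_le[OF Y_zero, of x] by simp

lemma infdist_add_le: "infdist (x + y) Y \<le> infdist x Y + infdist y Y"
proof (rule field_le_epsilon)
  fix e :: real assume "0 < e"
  then obtain u v where uv: "u \<in> Y" "v \<in> Y" "norm (x - u) < infdist x Y + e / 2" "norm (y - v) < infdist y Y + e / 2"
    using infdist_less_witness[of x "infdist x Y + e / 2"] infdist_less_witness[of y "infdist y Y + e / 2"]
    by auto
  have "infdist (x + y) Y \<le> norm ((x - u) + (y - v))"
    using infdist_le[OF Y_add[OF uv(1,2)], of "x + y"] by (simp add: dist_norm algebra_simps)
  also have "\<dots> \<le> norm (x - u) + norm (y - v)"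
    by (rule norm_triangle_ineq)
  finally show "infdist (x + y) Y \<le> infdist x Y + infdist y Y + e"
    using uv by simp
qed

lemma infdist_scl: "infdist (scl c x) Y = norm c * infdist x Y"
proof -
  have le: "infdist (scl c x) Y \<le> norm c * infdist x Y" if c: "c \<noteq> 0" for c x
  proof (rule field_le_epsilon)
    fix e :: real assume "0 < e"
    with c have "0 < e / norm c" by simp
    then obtain u where u: "u \<in> Y" "norm (x - u) < infdist x Y + e / norm c"
      using infdist_less_witness[of x "infdist x Y + e / norm c"] by auto
    have "infdist (scl c x) Y \<le> norm c * norm (x - u)"
      using infdist_le[OF Y_scl[OF u(1), of c], of "scl c x"]
      by (simp add: dist_norm flip: scale_right_diff_distrib)
    also have "\<dots> \<le> norm c * (infdist x Y + e / norm c)"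
      using u by (intro mult_left_mono) auto
    finally show "infdist (scl c x) Y \<le> norm c * infdist x Y + e"
      using c by (simp add: algebra_simps)
  qed
  show ?thesis
  proof (cases "c = 0")
    case True
    then show ?thesis using Y_zero by simp
  next
    case False
    have "infdist x Y \<le> norm (inverse c) * infdist (scl c x) Y"
      using le[of "inverse c" "scl c x"] False by simp
    then have "norm c * infdist x Y \<le> norm c * (norm (inverse c) * infdist (scl c x) Y)"
      by (intro mult_left_mono) auto
    also have "\<dots> = infdist (scl c x) Y"
      using False by (simp add: norm_inverse)
    finally have "norm c * infdist x Y \<le> infdist (scl c x) Y" .
    then show ?thesis
      using le[OF False, of x] by simp
  qed
qed

lemma T_tree_quotient_iff:
  "map coset xs \<in> T_tree p (quotient_by scl Y) K \<longleftrightarrow> (\<forall>x\<in>set xs. infdist x Y \<le> 1) \<and>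
    (\<forall>as. length as = length xs \<and> lp_norm p as = 1 \<longrightarrow>
       1 / K \<le> infdist (lin as xs) Y \<and> infdist (lin as xs) Y \<le> 1)"
proof -
  have "coset x \<in> points (quotient_by scl Y)" for x
    by (auto simp: quotient_by_def coset_def)
  then show ?thesis
    by (auto simp: T_tree_def lincomb_quotient nrm_quotient)
qed

text \<open>
  The quotient map is a contraction, so the lower estimate is the only one that can fail for the
  images of an \<open>\<ell>\<^sub>p\<close> system.  Its failure provides a normalized combination close to \<open>Y\<close>.
\<close>

lemma combination_close_to_subspace:
  assumes "1 \<le> p" "xs \<in> T_tree p (subspace_of scl UNIV) K"
    and "map coset xs \<notin> T_tree p (quotient_by scl Y) (1 / e)"
  obtains as where "length as = length xs" "lp_norm p as = 1" "infdist (lin as xs) Y < e"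
proof -
  have ub: "norm (lin as xs) \<le> 1" if "length as = length xs" "lp_norm p as = 1" for as
    using assms(2) that unfolding T_tree_subspace_iff[OF assms(1)] by blast
  then have "norm x \<le> 1" if "x \<in> set xs" for x
    using lin_unit[OF that] lp_norm_unit[OF assms(1)] by metis
  then have "\<forall>x\<in>set xs. infdist x Y \<le> 1"
    using infdist_le_norm order.trans by blast
  moreover have "infdist (lin as xs) Y \<le> 1" if "length as = length xs" "lp_norm p as = 1" for as
    using ub[OF that] infdist_le_norm order.trans by blast
  ultimately obtain as where "length as = length xs" "lp_norm p as = 1" "\<not> 1 / (1 / e) \<le> infdist (lin as xs) Y"
    using assms(3) unfolding T_tree_quotient_iff by blast
  then show thesis
    by (intro that) auto
qed

definition near_block :: "ennreal \<Rightarrow> real \<Rightarrow> 'k list \<Rightarrow> 'a list \<Rightarrow> 'a \<Rightarrow> bool" where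
  "near_block p e as xs y \<longleftrightarrow>
     length as = length xs \<and> lp_norm p as = 1 \<and> y \<in> Y \<and> norm (lin as xs - y) \<le> e"

lemma near_block_if_infdist_less:
  assumes "length as = length xs" "lp_norm p as = 1" "infdist (lin as xs) Y < e"
  shows "\<exists>y. near_block p e as xs y"
  using infdist_less_witness[OF assms(3)] assms(1,2) unfolding near_block_def
  by (meson order.strict_implies_order)

text \<open>
  Normalized blocks of an \<open>\<ell>\<^sub>p\<close> system with constant \<open>K\<close> satisfy the same estimates.  Moving them
  into \<open>Y\<close> costs \<open>\<delta>\<close> on both sides, and division by \<open>1 + \<delta>\<close> restores the upper estimate.
\<close>

lemma perturbed_blocks:
  assumes p: "1 \<le> p" and T: "concat (map t js) \<in> T_tree p (subspace_of scl UNIV) K"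
    and js: "distinct js" and near: "\<And>j. j \<in> set js \<Longrightarrow> near_block p (\<epsilon> j) (a j) (t j) (y j)"
    and \<epsilon>: "dual_bound p \<epsilon> \<delta>" and \<delta>: "0 \<le> \<delta>" "(1 + \<delta>) / C \<le> 1 / K - \<delta>"
  shows "map (\<lambda>j. scl (of_real (1 / (1 + \<delta>))) (y j)) js \<in> T_tree p (subspace_of scl Y) C"
proof -
  let ?r = "of_real (1 / (1 + \<delta>)) :: 'k"
  let ?z = "\<lambda>j. lin (a j) (t j)"
  have norm_r: "norm ?r = 1 / (1 + \<delta>)"
    using \<delta>(1) by (simp only: norm_of_real) simp
  have "1 / C \<le> norm (lin bs (map (\<lambda>j. scl ?r (y j)) js)) \<and> norm (lin bs (map (\<lambda>j. scl ?r (y j)) js)) \<le> 1"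
    if bs: "length bs = length js" "lp_norm p bs = 1" for bs
  proof -
    let ?c = "concat (map (\<lambda>(b, j). map ((*) b) (a j)) (zip bs js))"
    have len: "length (a j) = length (t j)" if "j \<in> set js" for j
      using near[OF that] by (simp add: near_block_def)
    have "length ?c = length (concat (map t js))"
      using bs(1) len by (induction bs js rule: list_induct2) auto
    moreover have "lp_norm p ?c = 1"
      using p bs(1) _ bs(2) by (rule lp_norm_blocks) (use near in \<open>simp add: near_block_def\<close>)
    ultimately have "1 / K \<le> norm (lin ?c (concat (map t js))) \<and> norm (lin ?c (concat (map t js))) \<le> 1"
      using T unfolding T_tree_subspace_iff[OF p] by blast
    then have z: "1 / K \<le> norm (lin bs (map ?z js))" "norm (lin bs (map ?z js)) \<le> 1"
      using lin_concat[of bs js a t, OF bs(1) len] by simp_all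
    have "norm (lin bs (map ?z js) - lin bs (map y js)) \<le> (\<Sum>(b, j)\<leftarrow>zip bs js. norm b * \<epsilon> j)"
      using bs(1) near by (intro norm_lin_diff_le) (auto simp: near_block_def)
    also have "\<dots> \<le> \<delta>"
      using \<epsilon> js bs by (rule dual_boundD)
    finally have "norm (lin bs (map ?z js) - lin bs (map y js)) \<le> \<delta>" .
    then have y: "1 / K - \<delta> \<le> norm (lin bs (map y js))" "norm (lin bs (map y js)) \<le> 1 + \<delta>"
      using z norm_triangle_ineq2[of "lin bs (map ?z js)" "lin bs (map y js)"]
        norm_triangle_ineq2[of "lin bs (map y js)" "lin bs (map ?z js)"]
      by (auto simp: norm_minus_commute)
    have eq: "norm (lin bs (map (\<lambda>j. scl ?r (y j)) js)) = norm (lin bs (map y js)) / (1 + \<delta>)"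
      unfolding lin_map_scl norm_scl norm_r by simp
    have "(1 + \<delta>) / C \<le> norm (lin bs (map y js))"
      using y(1) \<delta>(2) by simp
    then have "1 / C \<le> norm (lin bs (map y js)) / (1 + \<delta>)"
      using \<delta>(1) by (simp add: field_simps)
    then show ?thesis
      unfolding eq using y(2) \<delta>(1) by simp
  qed
  moreover have "scl ?r (y j) \<in> Y" if "j \<in> set js" for j
    using near[OF that] Y_scl by (simp add: near_block_def)
  ultimately show ?thesis
    unfolding T_tree_subspace_iff[OF p] by auto
qed

end


section \<open>Products of tree orders\<close>

lemma lp_norm_replicate_zero_append: "lp_norm p (replicate n 0 @ as) = lp_norm p as"
proof -
  have "insert 0 (norm ` set (replicate n 0 @ as)) = insert 0 (norm ` set as)"
    by auto
  then show ?thesis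
    by (simp only: lp_norm_def) (simp add: sum_list_replicate)
qed

lemma Nil_in_T_tree: "[] \<in> T_tree p V K"
  by (simp add: T_tree_def)

context normed_subspace
begin

lemma T_tree_suffix:
  assumes "1 \<le> p" "us @ vs \<in> T_tree p (subspace_of scl Z) K"
  shows "vs \<in> T_tree p (subspace_of scl Z) K"
proof -
  have "lin (replicate (length us) 0 @ as) (us @ vs) = lin as vs" for as
    by (simp add: lin_append lin_replicate_zero)
  moreover have "length (replicate (length us) 0 @ as) = length (us @ vs)" if "length as = length vs" for as :: "'k list"
    using that by simp
  ultimately show ?thesis
    using assms(2) lp_norm_replicate_zero_append unfolding T_tree_subspace_iff[OF assms(1)]
    by (metis Un_subset_iff set_append)
qed

text \<open>
  If \<open>s\<close> survives \<open>\<alpha> (\<gamma> + 1)\<close> derivations of the tree of \<open>X\<close>, then the tree of its extensions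
  which survive \<open>\<alpha> \<gamma>\<close> derivations has order above \<open>\<alpha>\<close>.  Its image in the quotient cannot be
  contained in a tree of order at most \<open>\<alpha>\<close>, hence \<open>s\<close> can be extended by a block close to \<open>Y\<close>, at
  the price of \<open>\<alpha>\<close> derivations.  A sequence of \<open>n\<close> such blocks in \<open>X\<close> is tied to a node of length
  \<open>n\<close> of the tree of \<open>Y\<close>.
\<close>

lemma block_tree_deriv:
  assumes p: "1 \<le> p" and \<epsilon>: "dual_bound p \<epsilon> \<delta>" and \<delta>: "0 \<le> \<delta>" "(1 + \<delta>) / C \<le> 1 / K - \<delta>"
    and empty: "\<And>k. tree_deriv \<alpha> (T_tree p (quotient_by scl Y) (1 / \<epsilon> k)) = {}"
    and "concat (map t [0..<n]) \<in> tree_deriv (\<alpha> * \<gamma>) (T_tree p (subspace_of scl UNIV) K)"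
    and "\<And>j. j < n \<Longrightarrow> near_block p (\<epsilon> j) (a j) (t j) (y j)"
  shows "map (\<lambda>j. scl (of_real (1 / (1 + \<delta>))) (y j)) [0..<n]
    \<in> tree_deriv \<gamma> (T_tree p (subspace_of scl Y) C)"
  using assms(6,7)
proof (induction \<gamma> arbitrary: n t a y rule: ordinal_induct)
  case zero
  then show ?case
    using perturbed_blocks[OF p _ _ _ \<epsilon> \<delta>, of t "[0..<n]" a y] by simp
next
  case (succ \<gamma>)
  let ?T = "T_tree p (subspace_of scl UNIV) K"
  let ?T\<gamma> = "tree_deriv (\<alpha> * \<gamma>) ?T"
  let ?s = "concat (map t [0..<n])"
  let ?f = "\<lambda>u. map coset (drop (length ?s) u)"
  have s: "?s \<in> tree_deriv \<alpha> ?T\<gamma>"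
    using succ.prems(1) tree_deriv_add by auto
  have "\<exists>u\<in>?T\<gamma>. prefix ?s u \<and> ?f u \<notin> T_tree p (quotient_by scl Y) (1 / \<epsilon> n)"
  proof (rule ccontr)
    assume "\<not> ?thesis"
    then have "?f ?s \<in> tree_deriv \<alpha> (T_tree p (quotient_by scl Y) (1 / \<epsilon> n))"
      by (intro tree_deriv_map[OF _ _ s]) (auto simp: prefix_def strict_prefix_def)
    then show False by (simp add: empty)
  qed
  then obtain v where v: "?s @ v \<in> ?T\<gamma>" "map coset v \<notin> T_tree p (quotient_by scl Y) (1 / \<epsilon> n)"
    by (auto simp: prefix_def)
  have "?s @ v \<in> ?T"
    using v(1) tree_deriv_antimono[OF zero_le_ordinal[of "\<alpha> * \<gamma>"], of ?T] by auto
  then have "v \<in> ?T"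
    by (rule T_tree_suffix[OF p])
  then obtain b where "length b = length v" "lp_norm p b = 1" "infdist (lin b v) Y < \<epsilon> n"
    using v(2) by (rule combination_close_to_subspace[OF p])
  then obtain w where w: "near_block p (\<epsilon> n) b v w"
    using near_block_if_infdist_less by blast
  let ?g = "\<lambda>y j. scl (of_real (1 / (1 + \<delta>))) (y j)"
  have "map (?g (y(n := w))) [0..<Suc n] \<in> tree_deriv \<gamma> (T_tree p (subspace_of scl Y) C)"
  proof (rule succ.IH)
    show "concat (map (t(n := v)) [0..<Suc n]) \<in> ?T\<gamma>"
      using v(1) by simp
    show "near_block p (\<epsilon> j) ((a(n := b)) j) ((t(n := v)) j) ((y(n := w)) j)" if "j < Suc n" for j
      using that w succ.prems(2) by auto
  qed
  moreover have "map (?g y) [0..<n] \<in> tree_deriv \<gamma> (T_tree p (subspace_of scl Y) C)"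
  proof (rule succ.IH)
    show "?s \<in> ?T\<gamma>"
      using s tree_deriv_antimono[OF zero_le_ordinal[of \<alpha>], of ?T\<gamma>] by auto
  qed (rule succ.prems(2))
  moreover have "map (?g (y(n := w))) [0..<Suc n] = map (?g y) [0..<n] @ [?g (y(n := w)) n]"
    by auto
  then have "strict_prefix (map (?g y) [0..<n]) (map (?g (y(n := w))) [0..<Suc n])"
    by (simp only: strict_prefix_def prefix_def) simp
  ultimately show ?case
    by (auto simp: mem_prune_iff)
next
  case (limit \<gamma>)
  have "map (\<lambda>j. scl (of_real (1 / (1 + \<delta>))) (y j)) [0..<n]
    \<in> tree_deriv \<zeta> (T_tree p (subspace_of scl Y) C)" if \<zeta>: "\<zeta> < \<gamma>" for \<zeta>
  proof (rule limit.IH[OF \<zeta>])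
    show "concat (map t [0..<n]) \<in> tree_deriv (\<alpha> * \<zeta>) (T_tree p (subspace_of scl UNIV) K)"
      using limit.prems(1) tree_deriv_antimono[OF mult_le_mult_limit[OF limit.hyps \<zeta>]] by blast
  qed (rule limit.prems(2))
  then show ?case
    by (simp add: tree_deriv_limit limit.hyps)
qed

lemma I_index_const_le_mult:
  assumes "1 \<le> p" "dual_bound p \<epsilon> \<delta>" "0 \<le> \<delta>" "(1 + \<delta>) / C \<le> 1 / K - \<delta>"
    and X: "\<And>k. I_index_const p (quotient_by scl Y) (1 / \<epsilon> k) \<le> Ord \<alpha>"
    and Y: "I_index_const p (subspace_of scl Y) C \<le> Ord \<beta>"
  shows "I_index_const p (subspace_of scl UNIV) K \<le> Ord (\<alpha> * \<beta>)"
proof -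
  have "tree_deriv (\<alpha> * \<beta>) (T_tree p (subspace_of scl UNIV) K) = {}"
  proof (rule ccontr)
    assume "\<not> ?thesis"
    then have "[] \<in> tree_deriv (\<alpha> * \<beta>) (T_tree p (subspace_of scl UNIV) K)"
      by (rule Nil_in_tree_deriv[OF Nil_in_T_tree])
    then have "[] \<in> tree_deriv \<beta> (T_tree p (subspace_of scl Y) C)"
      using block_tree_deriv[OF assms(1-4), where n = 0 and \<alpha> = \<alpha> and \<gamma> = \<beta>] X
      by (simp add: I_index_const_def tree_order_le_iff)
    then show False
      using Y by (simp add: I_index_const_def tree_order_le_iff)
  qed
  then show ?thesis
    by (simp add: I_index_const_def tree_order_le_iff)
qed

end


section \<open>Spreading models of blocks\<close>

lemma sorted_list_of_set_set: "sorted_wrt (<) xs \<Longrightarrow> sorted_list_of_set (set xs) = xs"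
  for xs :: "nat list"
  by (simp add: strict_sorted_iff sorted_list_of_set.idem_if_sorted_distinct)

lemma sorted_list_of_set_image:
  fixes f :: "nat \<Rightarrow> nat"
  assumes "strict_mono f" "finite E"
  shows "sorted_list_of_set (f ` E) = map f (sorted_list_of_set E)"
proof -
  have "sorted_wrt (<) (map f (sorted_list_of_set E))"
    using assms(1) by (simp add: sorted_wrt_map strict_mono_less)
  then have "sorted_list_of_set (set (map f (sorted_list_of_set E))) = map f (sorted_list_of_set E)"
    by (rule sorted_list_of_set_set)
  then show ?thesis
    using assms(2) by simp
qed

lemma sorted_list_of_set_UN:
  fixes E :: "nat \<Rightarrow> nat set"
  assumes "finite A" "\<And>i. i \<in> A \<Longrightarrow> finite (E i)"
    and "\<And>i j x y. i \<in> A \<Longrightarrow> j \<in> A \<Longrightarrow> i < j \<Longrightarrow> x \<in> E i \<Longrightarrow> y \<in> E j \<Longrightarrow> x < y"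
  shows "sorted_list_of_set (\<Union>i\<in>A. E i) = concat (map (\<lambda>i. sorted_list_of_set (E i)) (sorted_list_of_set A))"
proof -
  let ?l = "\<lambda>js. concat (map (\<lambda>i. sorted_list_of_set (E i)) js)"
  have set: "set (?l js) = (\<Union>i\<in>set js. E i)" if "set js \<subseteq> A" for js
    using assms(2) that by (auto simp: subset_iff)
  have "sorted_wrt (<) js \<Longrightarrow> set js \<subseteq> A \<Longrightarrow> sorted_wrt (<) (?l js)" for js
  proof (induction js)
    case (Cons j js)
    have "x < y" if xy: "x \<in> set (sorted_list_of_set (E j))" "y \<in> set (?l js)" for x y
    proof -
      obtain i where "i \<in> set js" "y \<in> E i"
        using xy(2) set[of js] Cons.prems(2) by auto
      moreover have "x \<in> E j"
        using xy(1) assms(2) Cons.prems(2) by auto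
      ultimately show ?thesis
        using assms(3)[of j i x y] Cons.prems by auto
    qed
    with Cons show ?case
      by (simp add: sorted_wrt_append)
  qed simp
  then have "sorted_list_of_set (set (?l (sorted_list_of_set A))) = ?l (sorted_list_of_set A)"
    using assms(1) by (intro sorted_list_of_set_set) simp
  then show ?thesis
    using set[of "sorted_list_of_set A"] assms(1) by simp
qed

lemma SM_index_const_le_iff:
  "SM_index_const S p V K \<le> Ord \<xi> \<longleftrightarrow> (\<exists>\<eta>\<le>omega1. \<eta> \<le> \<xi> \<and> (\<nexists>x. spreading_model S p V K \<eta> x))"
proof -
  let ?P = "\<lambda>\<eta>. \<eta> \<le> omega1 \<and> (\<nexists>x. spreading_model S p V K \<eta> x)"
  have "?P (LEAST \<eta>. ?P \<eta>)" if "\<exists>\<eta>. ?P \<eta>"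
    using that by (rule LeastI_ex)
  moreover have "(LEAST \<eta>. ?P \<eta>) \<le> \<eta>" if "?P \<eta>" for \<eta>
    using that by (rule Least_le)
  ultimately show ?thesis
    unfolding SM_index_const_def by (auto intro: order.trans)
qed

text \<open>A tail of a model of order \<open>\<xi>\<close> is one of order \<open>\<eta> \<le> \<xi>\<close>, since \<open>S \<eta> \<subseteq> S \<xi>\<close> beyond some integer.\<close>

lemma spreading_model_shift:
  assumes "schreier_families S" "\<eta> \<le> \<xi>" "\<xi> \<le> omega1" "spreading_model S p V K \<xi> x"
  shows "\<exists>x'. spreading_model S p V K \<eta> x'"
proof -
  obtain k where k: "\<forall>E\<in>S \<eta>. (\<forall>n\<in>E. k \<le> n) \<longrightarrow> E \<in> S \<xi>"
    using schreier_almost_mono[OF assms(1-3)] by blast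
  have "\<eta> \<le> omega1"
    using assms(2,3) by (rule order.trans)
  have sm: "strict_mono (\<lambda>n. n + k)"
    by (simp add: strict_mono_def)
  have "map (\<lambda>n. x (n + k)) (sorted_list_of_set E) \<in> T_tree p V K" if E: "E \<in> S \<eta>" for E
  proof -
    have fin: "finite E"
      using schreier_finite[OF assms(1) \<open>\<eta> \<le> omega1\<close> E] by blast
    have "(\<lambda>n. n + k) ` E \<in> S \<eta>"
      using assms(1) \<open>\<eta> \<le> omega1\<close> E by (rule schreier_spread) (auto simp: strict_mono_on_def)
    then have "(\<lambda>n. n + k) ` E \<in> S \<xi>"
      using k by auto
    then have "map x (sorted_list_of_set ((\<lambda>n. n + k) ` E)) \<in> T_tree p V K"
      using assms(4) unfolding spreading_model_def by blast
    then show ?thesis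
      by (simp add: sorted_list_of_set_image[OF sm fin] o_def)
  qed
  then have "spreading_model S p V K \<eta> (\<lambda>n. x (n + k))"
    using assms(4) unfolding spreading_model_def by auto
  then show ?thesis by blast
qed

lemma no_spreading_model:
  assumes "schreier_families S" "SM_index_const S p V K \<le> Ord \<xi>"
    and "\<theta> \<le> omega1" "\<xi> \<le> \<theta> \<or> \<theta> = omega1"
  shows "\<not> spreading_model S p V K \<theta> x"
proof -
  obtain \<eta> where \<eta>: "\<eta> \<le> omega1" "\<eta> \<le> \<xi>" "\<nexists>x. spreading_model S p V K \<eta> x"
    using assms(2) unfolding SM_index_const_le_iff by blast
  then have "\<eta> \<le> \<theta>"
    using assms(4) order.trans by blast
  then show ?thesis
    using spreading_model_shift[OF assms(1) _ assms(3)] \<eta>(3) by blast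
qed

context normed_subspace
begin

text \<open>
  Successive blocks from \<open>F\<close> which are close enough to \<open>Y\<close> give a sequence in \<open>Y\<close>.  The set of
  all indices involved in a member of \<open>G\<close> is a member of \<open>H\<close>, so the \<open>\<ell>\<^sub>p\<close> estimates on \<open>H\<close>
  carry over to estimates on \<open>G\<close>.
\<close>

lemma block_sequence:
  fixes x :: "nat \<Rightarrow> 'a"
  assumes p: "1 \<le> p" and \<epsilon>: "dual_bound p \<epsilon> \<delta>" and \<delta>: "0 \<le> \<delta>" "(1 + \<delta>) / C \<le> 1 / K - \<delta>"
    and H: "\<And>E. E \<in> H \<Longrightarrow> map x (sorted_list_of_set E) \<in> T_tree p (subspace_of scl UNIV) K"
    and G: "\<And>A. A \<in> G \<Longrightarrow> finite A" and F: "\<And>E. E \<in> F \<Longrightarrow> finite E"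
    and blocks: "\<And>A E. A \<in> G \<Longrightarrow> successive_blocks F A E \<Longrightarrow> (\<Union>i\<in>A. E i) \<in> H"
    and small: "\<And>k N. \<exists>E\<in>F. (\<forall>n\<in>E. N < n) \<and> (\<exists>as. length as = card E \<and> lp_norm p as = 1 \<and>
      infdist (lin as (map x (sorted_list_of_set E))) Y < \<epsilon> k)"
  shows "\<exists>y. (\<forall>n. y n \<in> Y) \<and> (\<forall>A\<in>G. map y (sorted_list_of_set A) \<in> T_tree p (subspace_of scl Y) C)"
proof -
  define P where "P = (\<lambda>k E. E \<in> F \<and> E \<noteq> {} \<and> (\<forall>n\<in>E. k \<le> n) \<and>
    (\<exists>as y. near_block p (\<epsilon> k) as (map x (sorted_list_of_set E)) y))"
  have ex: "\<exists>E. P k E \<and> (\<forall>n\<in>E. N < n)" for k N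
  proof -
    obtain E as where E: "E \<in> F" "\<forall>n\<in>E. N + k < n" "length as = card E" "lp_norm p as = 1"
      "infdist (lin as (map x (sorted_list_of_set E))) Y < \<epsilon> k"
      using small[of "N + k" k] by blast
    have "E \<noteq> {}"
      using E(3,4) by auto
    moreover have "\<exists>y. near_block p (\<epsilon> k) as (map x (sorted_list_of_set E)) y"
      using E(3-5) by (intro near_block_if_infdist_less) auto
    ultimately show ?thesis
      using E(1,2) unfolding P_def by (intro exI[of _ E]) (auto intro: less_imp_le dest: add_lessD1)
  qed
  have "\<exists>E. \<forall>k. P k (E k) \<and> (\<forall>m\<in>E k. \<forall>n\<in>E (Suc k). m < n)"
  proof (rule dependent_nat_choice)
    show "\<exists>E. P 0 E"
      using ex by blast
    show "\<exists>E'. P (Suc k) E' \<and> (\<forall>m\<in>E. \<forall>n\<in>E'. m < n)" if "P k E" for E k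
    proof -
      have "finite E"
        using that F unfolding P_def by blast
      then obtain N where "\<forall>m\<in>E. m \<le> N"
        using finite_nat_set_iff_bounded_le by blast
      then show ?thesis
        using ex[of "Suc k" N] order.strict_trans1 by blast
    qed
  qed
  then obtain E where P: "\<And>k. P k (E k)" and step: "\<And>k m n. m \<in> E k \<Longrightarrow> n \<in> E (Suc k) \<Longrightarrow> m < n"
    by blast
  have less: "m < n" if "i < j" "m \<in> E i" "n \<in> E j" for i j m n
    using that(1,3)
  proof (induction j arbitrary: n)
    case (Suc j)
    show ?case
    proof (cases "i = j")
      case True
      then show ?thesis using step that(2) Suc.prems by blast
    next
      case False
      obtain l where "l \<in> E j"
        using P[of j] unfolding P_def by blast
      then show ?thesis
        using Suc False step[of l j n] by force
    qed
  qed simp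
  have "\<exists>a y. near_block p (\<epsilon> k) a (map x (sorted_list_of_set (E k))) y" for k
    using P[of k] unfolding P_def by blast
  then obtain a y where near: "\<And>k. near_block p (\<epsilon> k) (a k) (map x (sorted_list_of_set (E k))) (y k)"
    by metis
  let ?y = "\<lambda>k. scl (of_real (1 / (1 + \<delta>))) (y k)"
  have "map ?y (sorted_list_of_set A) \<in> T_tree p (subspace_of scl Y) C" if A: "A \<in> G" for A
  proof (rule perturbed_blocks[OF p _ _ near \<epsilon> \<delta>])
    have finE: "finite (E i)" for i
      using P[of i] F unfolding P_def by blast
    have "successive_blocks F A E"
      using P less unfolding successive_blocks_def P_def by blast
    then have "map x (sorted_list_of_set (\<Union>i\<in>A. E i)) \<in> T_tree p (subspace_of scl UNIV) K"
      using blocks[OF A] H by blast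
    moreover have "sorted_list_of_set (\<Union>i\<in>A. E i)
        = concat (map (\<lambda>i. sorted_list_of_set (E i)) (sorted_list_of_set A))"
      using G[OF A] finE less by (intro sorted_list_of_set_UN) auto
    ultimately show "concat (map (\<lambda>k. map x (sorted_list_of_set (E k))) (sorted_list_of_set A))
        \<in> T_tree p (subspace_of scl UNIV) K"
      by (simp add: map_concat o_def)
  qed simp
  moreover have "?y n \<in> Y" for n
    using near[of n] Y_scl unfolding near_block_def by blast
  ultimately show ?thesis
    by (intro exI[of _ ?y]) blast
qed

text \<open>
  No sequence of images in the quotient is an \<open>\<ell>\<^sub>p\<^sup>\<xi>\<close> spreading model, whichever tail is taken.
  Each tail therefore contains a block with support in \<open>S \<xi>\<close> close to \<open>Y\<close>, and the resulting
  sequence in \<open>Y\<close> would be an \<open>\<ell>\<^sub>p\<^sup>\<zeta>\<close> spreading model.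
\<close>

lemma SM_index_const_le_plus:
  assumes S: "schreier_families S" and p: "1 \<le> p"
    and \<epsilon>: "dual_bound p \<epsilon> \<delta>" and \<delta>: "0 \<le> \<delta>" "(1 + \<delta>) / C \<le> 1 / K - \<delta>"
    and quot: "\<And>k. SM_index_const S p (quotient_by scl Y) (1 / \<epsilon> k) \<le> Ord \<xi>"
    and sub: "SM_index_const S p (subspace_of scl Y) C \<le> Ord \<zeta>"
  shows "SM_index_const S p (subspace_of scl UNIV) K \<le> Ord (\<xi> + \<zeta>)"
proof (rule ccontr)
  assume "\<not> ?thesis"
  then have model: "\<exists>x. spreading_model S p (subspace_of scl UNIV) K \<eta> x"
    if "\<eta> \<le> omega1" "\<eta> \<le> \<xi> + \<zeta>" for \<eta>
    using that unfolding SM_index_const_le_iff by blast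
  \<comment> \<open>\<open>\<theta>\<close> and \<open>\<theta>'\<close> are \<open>\<xi>\<close> and \<open>\<zeta>\<close> if \<open>\<xi> + \<zeta> < \<omega>\<^sub>1\<close>.  Otherwise there is a model of order \<open>\<omega>\<^sub>1\<close>, and all
    finite sets play the role of each of the families.\<close>
  have "\<exists>\<theta> \<theta>' H x. \<theta> \<le> omega1 \<and> (\<xi> \<le> \<theta> \<or> \<theta> = omega1) \<and> \<theta>' \<le> omega1 \<and> (\<zeta> \<le> \<theta>' \<or> \<theta>' = omega1) \<and>
    (\<forall>E\<in>H. map x (sorted_list_of_set E) \<in> T_tree p (subspace_of scl UNIV) K) \<and>
    (\<forall>A E. A \<in> S \<theta>' \<longrightarrow> successive_blocks (S \<theta>) A E \<longrightarrow> (\<Union>i\<in>A. E i) \<in> H)"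
  proof (cases "\<xi> + \<zeta> < omega1")
    case True
    have le: "\<xi> \<le> omega1" "\<zeta> \<le> omega1" "\<xi> + \<zeta> \<le> omega1"
      using True le_add_left_ordinal[of \<xi> \<zeta>] le_add_right_ordinal[of \<zeta> \<xi>]
      by (meson order.strict_implies_order order.trans)+
    obtain x where x: "spreading_model S p (subspace_of scl UNIV) K (\<xi> + \<zeta>) x"
      using model le by blast
    obtain m where m: "strict_mono m"
      "\<forall>A\<in>S \<zeta>. \<forall>E. successive_blocks (S \<xi>) A E \<longrightarrow> m ` (\<Union>i\<in>A. E i) \<in> S (\<xi> + \<zeta>)"
      using schreier_sum[OF S True] by blast
    let ?H = "{E. finite E \<and> m ` E \<in> S (\<xi> + \<zeta>)}"
    have H: "map (x \<circ> m) (sorted_list_of_set E) \<in> T_tree p (subspace_of scl UNIV) K" if "E \<in> ?H" for E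
      using that x unfolding spreading_model_def
      by (auto simp: sorted_list_of_set_image[OF m(1)] simp flip: map_map)
    have UN: "(\<Union>i\<in>A. E i) \<in> ?H" if "A \<in> S \<zeta>" "successive_blocks (S \<xi>) A E" for A E
    proof -
      have "finite A"
        using schreier_finite[OF S le(2) that(1)] by blast
      moreover have "finite (E i)" if "i \<in> A" for i
        using schreier_finite[OF S le(1)] \<open>successive_blocks (S \<xi>) A E\<close> that
        unfolding successive_blocks_def by blast
      ultimately show ?thesis
        using m(2) that by blast
    qed
    show ?thesis
    proof (intro exI conjI ballI allI impI)
      show "\<xi> \<le> omega1" "\<xi> \<le> \<xi> \<or> \<xi> = omega1" "\<zeta> \<le> omega1" "\<zeta> \<le> \<zeta> \<or> \<zeta> = omega1"
        using le by auto
    qed (fact H, fact UN)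
  next
    case False
    then obtain x where x: "spreading_model S p (subspace_of scl UNIV) K omega1 x"
      using model[OF order.refl] leI by blast
    have "(\<Union>i\<in>A. E i) \<in> S omega1" if "A \<in> S omega1" "successive_blocks (S omega1) A E" for A E
      using that unfolding successive_blocks_def schreier_omega1[OF S] by auto
    then show ?thesis
      using x unfolding spreading_model_def
      by (intro exI[of _ omega1] exI[of _ omega1] exI[of _ "S omega1"] exI[of _ x]) blast
  qed
  then obtain \<theta> \<theta>' H x where \<theta>: "\<theta> \<le> omega1" "\<xi> \<le> \<theta> \<or> \<theta> = omega1"
    and \<theta>': "\<theta>' \<le> omega1" "\<zeta> \<le> \<theta>' \<or> \<theta>' = omega1"
    and H: "\<And>E. E \<in> H \<Longrightarrow> map x (sorted_list_of_set E) \<in> T_tree p (subspace_of scl UNIV) K"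
    and blocks: "\<And>A E. A \<in> S \<theta>' \<Longrightarrow> successive_blocks (S \<theta>) A E \<Longrightarrow> (\<Union>i\<in>A. E i) \<in> H"
    by metis
  have "\<exists>E\<in>S \<theta>. (\<forall>n\<in>E. N < n) \<and> (\<exists>as. length as = card E \<and> lp_norm p as = 1 \<and>
      infdist (lin as (map x (sorted_list_of_set E))) Y < \<epsilon> k)" for k N
  proof -
    have "\<not> spreading_model S p (quotient_by scl Y) (1 / \<epsilon> k) \<theta> (\<lambda>n. coset (x (n + N)))"
      using no_spreading_model[OF S quot \<theta>] .
    moreover have "coset v \<in> points (quotient_by scl Y)" for v
      by (auto simp: quotient_by_def coset_def)
    ultimately obtain E where E: "E \<in> S \<theta>"
      "map (\<lambda>n. coset (x (n + N))) (sorted_list_of_set E) \<notin> T_tree p (quotient_by scl Y) (1 / \<epsilon> k)"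
      unfolding spreading_model_def by blast
    let ?f = "\<lambda>n. n + N"
    have fin: "finite E" "E \<subseteq> {1..}"
      using schreier_finite[OF S \<theta>(1) E(1)] by auto
    have sm: "strict_mono ?f"
      by (simp add: strict_mono_def)
    have E': "?f ` E \<in> S \<theta>"
      using S \<theta>(1) E(1) by (rule schreier_spread) (auto simp: strict_mono_on_def)
    have "E \<noteq> {}"
      using E(2) by (auto simp: Nil_in_T_tree)
    have "successive_blocks (S \<theta>) {1} (\<lambda>_. ?f ` E)"
      using E' \<open>E \<noteq> {}\<close> fin by (auto simp: successive_blocks_def)
    then have "?f ` E \<in> H"
      using blocks[OF schreier_singleton[OF S \<theta>'(1) order.refl]] by simp
    then have "map x (sorted_list_of_set (?f ` E)) \<in> T_tree p (subspace_of scl UNIV) K"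
      by (rule H)
    moreover have "map coset (map x (sorted_list_of_set (?f ` E))) \<notin> T_tree p (quotient_by scl Y) (1 / \<epsilon> k)"
      using E(2) by (simp add: sorted_list_of_set_image[OF sm fin(1)] o_def)
    ultimately obtain as where "length as = length (map x (sorted_list_of_set (?f ` E)))"
      "lp_norm p as = 1" "infdist (lin as (map x (sorted_list_of_set (?f ` E)))) Y < \<epsilon> k"
      by (rule combination_close_to_subspace[OF p])
    moreover have "\<forall>n\<in>?f ` E. N < n"
      using fin(2) by auto
    ultimately show ?thesis
      using E' by (intro bexI[of _ "?f ` E"]) auto
  qed
  then obtain y where "\<forall>n. y n \<in> Y" "\<forall>A\<in>S \<theta>'. map y (sorted_list_of_set A) \<in> T_tree p (subspace_of scl Y) C"
    using block_sequence[OF p \<epsilon> \<delta>, of H x "S \<theta>'" "S \<theta>"] H blocks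
      schreier_finite[OF S \<theta>(1)] schreier_finite[OF S \<theta>'(1)] by blast
  then have "spreading_model S p (subspace_of scl Y) C \<theta>' y"
    unfolding spreading_model_def by simp
  then show False
    using no_spreading_model[OF S sub \<theta>'] by blast
qed

end


section \<open>Selecting sequences with lower \<open>c\<^sub>0\<close> estimates in the quotient\<close>

lemma finite_net_unit_ball:
  assumes "0 < (\<eta> :: real)"
  shows "\<exists>D :: 'k :: euclidean_space set. finite D \<and> (\<forall>c. norm c \<le> 1 \<longrightarrow> (\<exists>d\<in>D. norm (c - d) < \<eta>))"
proof -
  have "compact (cball (0 :: 'k) 1)"
    by (rule compact_cball)
  then obtain D :: "'k set" where "finite D" "cball 0 1 \<subseteq> (\<Union>d\<in>D. ball d \<eta>)"
    using assms unfolding compact_eq_totally_bounded by blast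
  then show ?thesis
    by (intro exI[of _ D]) (force simp: dist_norm norm_minus_commute subset_iff)
qed

lemma schreier_one_subset:
  fixes S :: "'a ordinal \<Rightarrow> nat set set"
  assumes S: "schreier_families S" and \<xi>: "0 < \<xi>" "\<xi> \<le> omega1"
  shows "\<exists>k\<ge>1. \<forall>F. finite F \<longrightarrow> (\<forall>n\<in>F. k \<le> n \<and> card F \<le> n) \<longrightarrow> F \<in> S \<xi>"
proof (cases "\<xi> = omega1")
  case True
  then show ?thesis
    by (intro exI[of _ 1]) (auto simp: schreier_omega1[OF S])
next
  case False
  then have "\<xi> < omega1"
    using \<xi>(2) by (rule order.not_eq_order_implies_strict)
  with osucc_le[OF \<xi>(1)] have lt: "osucc 0 < (omega1 :: 'a ordinal)"
    by (rule order.strict_trans1)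
  obtain k where k: "\<forall>E\<in>S (osucc 0). (\<forall>n\<in>E. k \<le> n) \<longrightarrow> E \<in> S \<xi>"
    using schreier_almost_mono[OF S osucc_le[OF \<xi>(1)] \<xi>(2)] by blast
  have "F \<in> S \<xi>" if F: "finite F" "\<forall>n\<in>F. Suc k \<le> n \<and> card F \<le> n" for F
  proof -
    let ?xs = "sorted_list_of_set F"
    let ?Es = "\<lambda>i. {?xs ! (i - 1)}"
    have mem: "?xs ! (i - 1) \<in> F" if "i \<in> {1..card F}" for i
    proof -
      have "?xs ! (i - 1) \<in> set ?xs"
        using that by (intro nth_mem) auto
      then show ?thesis
        using F(1) by simp
    qed
    have "F \<subseteq> (\<Union>i\<in>{1..card F}. ?Es i)"
    proof
      fix n assume "n \<in> F"
      then obtain i where "i < length ?xs" "?xs ! i = n"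
        using F(1) by (metis in_set_conv_nth set_sorted_list_of_set)
      then show "n \<in> (\<Union>i\<in>{1..card F}. ?Es i)"
        by (intro UN_I[of "Suc i"]) auto
    qed
    with mem have "F = (\<Union>i\<in>{1..card F}. ?Es i)"
      by blast
    moreover have "\<forall>i\<in>{1..card F}. ?Es i \<noteq> {} \<and> ?Es i \<in> S 0 \<and> (\<forall>x\<in>?Es i. card F \<le> x)"
      using mem F(2) by (force simp: schreier_zero[OF S])
    moreover have "\<forall>i\<in>{1..<card F}. \<forall>x\<in>?Es i. \<forall>y\<in>?Es (Suc i). x < y"
      using sorted_wrt_nth_less[OF strict_sorted_list_of_set, of _ _ F] by auto
    ultimately have "F \<in> S (osucc 0)"
      unfolding schreier_osucc_iff[OF S lt] by (intro exI[of _ "card F"] exI[of _ ?Es]) blast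
    then show ?thesis
      using k F(2) Suc_leD by blast
  qed
  then show ?thesis
    by (intro exI[of _ "Suc k"]) auto
qed

lemma list_eq_map_on_distinct:
  assumes "distinct js" "length as = length js"
  obtains c where "as = map c js" "\<And>j. c j = 0 \<or> c j \<in> set as"
proof -
  define c where "c = (\<lambda>j. case map_of (zip js as) j of Some a \<Rightarrow> a | None \<Rightarrow> 0)"
  have "as = map c js"
    using assms by (intro nth_equalityI) (auto simp: c_def map_of_zip_nth)
  moreover have "c j = 0 \<or> c j \<in> set as" for j
    by (auto simp: c_def split: option.split dest!: map_of_SomeD dest: set_zip_rightD)
  ultimately show thesis
    by (rule that)
qed

context normed_subspace
begin

lemma infdist_diff_le: "infdist x Y \<le> infdist y Y + infdist (x - y) Y"
  using infdist_add_le[of y "x - y"] by simp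

lemma infdist_minus: "infdist (- x) Y = infdist x Y"
  using infdist_scl[of "- 1" x] by simp

lemma infdist_sum_le: "infdist (\<Sum>i\<in>I. f i) Y \<le> (\<Sum>i\<in>I. infdist (f i) Y)"
proof (induction I rule: infinite_finite_induct)
  case (insert i I)
  then show ?case
    using infdist_add_le[of "f i" "\<Sum>i\<in>I. f i"] by simp
qed (use Y_zero in simp_all)

text \<open>
  The Mazur step for the selection of basic sequences, with averages in place of weak
  convergence.  If infinitely many \<open>w\<^sub>n\<close> reduced the seminorm of some combination of \<open>w\<^sub>0, \<dots>, w\<^sub>m\<close>
  by more than \<open>\<delta>\<close>, then by compactness they would do so, up to \<open>\<delta> / 2\<close>, for one combination and
  one coefficient.  The mean of \<open>N\<close> of these \<open>w\<^sub>n\<close> would also do so, but its seminorm is at most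
  \<open>1 / N\<close>.
\<close>

lemma mazur_step:
  fixes w :: "nat \<Rightarrow> 'a"
  assumes bound: "\<And>n. infdist (w n) Y \<le> 1"
    and sums: "\<And>B N. infinite B \<Longrightarrow> 0 < N \<Longrightarrow> \<exists>E\<subseteq>B. finite E \<and> card E = N \<and> infdist (\<Sum>n\<in>E. w n) Y \<le> 1"
    and "0 < \<delta>"
  shows "\<exists>N. \<forall>n>N. \<forall>c b. (\<forall>i. norm (c i) \<le> 1) \<longrightarrow> norm b \<le> 1 \<longrightarrow>
    infdist (\<Sum>i\<le>m. scl (c i) (w i)) Y \<le> infdist ((\<Sum>i\<le>m. scl (c i) (w i)) + scl b (w n)) Y + \<delta>"
proof (rule ccontr)
  let ?L = "\<lambda>c. \<Sum>i\<le>m. scl (c i) (w i)"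
  let ?bad = "\<lambda>n c b. (\<forall>i. norm (c i) \<le> 1) \<and> norm b \<le> 1 \<and>
    infdist (?L c + scl b (w n)) Y + \<delta> < infdist (?L c) Y"
  assume "\<not> ?thesis"
  then have unbounded: "\<forall>N. \<exists>n>N. \<exists>c b. ?bad n c b"
    by (meson linorder_not_le)
  define B where "B = {n. \<exists>c b. ?bad n c b}"
  have B1: "infinite B"
    unfolding B_def infinite_nat_iff_unbounded mem_Collect_eq by (rule unbounded)
  have "\<forall>n. \<exists>c. \<exists>b. n \<in> B \<longrightarrow> ?bad n c b"
    unfolding B_def by blast
  from choice[OF this] obtain c where "\<forall>n. \<exists>b. n \<in> B \<longrightarrow> ?bad n (c n) b" ..
  from choice[OF this] obtain b where "\<forall>n. n \<in> B \<longrightarrow> ?bad n (c n) (b n)" ..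
  with B1 have B: "infinite B" "\<And>n. n \<in> B \<Longrightarrow> ?bad n (c n) (b n)"
    by blast+
  define \<eta> where "\<eta> = \<delta> / (4 * (real m + 2))"
  have \<eta>: "0 < \<eta>" "(real m + 2) * \<eta> = \<delta> / 4"
    using \<open>0 < \<delta>\<close> by (auto simp: \<eta>_def field_simps)
  obtain D :: "'k set" where D: "finite D" "\<And>c. norm c \<le> 1 \<Longrightarrow> \<exists>d\<in>D. norm (c - d) < \<eta>"
    using finite_net_unit_ball[OF \<eta>(1)] by blast
  then obtain net where net: "\<And>c. norm c \<le> 1 \<Longrightarrow> net c \<in> D \<and> norm (c - net c) < \<eta>"
    by metis
  define code where "code = (\<lambda>n. (restrict (\<lambda>i. net (c n i)) {..m}, net (b n)))"
  have "code n \<in> (PiE {..m} (\<lambda>_. D)) \<times> D" if "n \<in> B" for n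
    using B(2)[OF that] net unfolding code_def by (intro SigmaI) (simp_all only: restrict_PiE_iff, blast+)
  then have "code ` B \<subseteq> (PiE {..m} (\<lambda>_. D)) \<times> D"
    by blast
  moreover have "finite ((PiE {..m} (\<lambda>_. D)) \<times> D)"
    using D(1) by (intro finite_cartesian_product finite_PiE) auto
  ultimately have "finite (code ` B)"
    by (rule finite_subset)
  then obtain n0 where "n0 \<in> B" and inf: "infinite {n \<in> B. code n = code n0}"
    using pigeonhole_infinite[OF B(1)] by blast
  define P where "P = ?L (\<lambda>i. net (c n0 i))"
  define e where "e = net (b n0)"
  have dec: "infdist (P + scl e (w n)) Y \<le> infdist P Y - \<delta> / 2" if n: "n \<in> B" "code n = code n0" for n
  proof -
    have eq: "net (c n i) = net (c n0 i)" if "i \<le> m" for i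
      using n(2) that by (auto simp: code_def restrict_def fun_eq_iff split: if_splits)
    have e: "e = net (b n)"
      using n(2) by (simp add: code_def e_def)
    have bad: "?bad n (c n) (b n)"
      using B(2) n(1) .
    have "infdist (scl (c n i) (w i) - scl (net (c n0 i)) (w i)) Y \<le> \<eta>" if "i \<le> m" for i
    proof -
      have "norm (c n i - net (c n i)) * infdist (w i) Y \<le> \<eta> * 1"
        using net[of "c n i"] bad bound \<eta>(1) by (intro mult_mono infdist_nonneg) (auto intro: less_imp_le)
      then show ?thesis
        by (simp add: eq[OF that] infdist_scl flip: scale_left_diff_distrib)
    qed
    then have "(\<Sum>i\<le>m. infdist (scl (c n i) (w i) - scl (net (c n0 i)) (w i)) Y) \<le> of_nat (card {..m}) * \<eta>"
      by (intro sum_bounded_above) auto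
    then have L: "infdist (?L (c n) - P) Y \<le> (real m + 1) * \<eta>"
      unfolding P_def sum_subtractf[symmetric] by (intro order.trans[OF infdist_sum_le]) (simp add: add.commute)
    have "norm (b n - e) * infdist (w n) Y \<le> \<eta> * 1"
      using net[of "b n"] bad bound \<eta>(1) unfolding e
      by (intro mult_mono infdist_nonneg) (auto intro: less_imp_le)
    then have b: "infdist (scl (b n) (w n) - scl e (w n)) Y \<le> \<eta>"
      by (simp add: infdist_scl flip: scale_left_diff_distrib)
    have "infdist (P + scl e (w n)) Y
        \<le> infdist (?L (c n) + scl (b n) (w n)) Y + infdist ((P + scl e (w n)) - (?L (c n) + scl (b n) (w n))) Y"
      by (rule infdist_diff_le)
    also have "(P + scl e (w n)) - (?L (c n) + scl (b n) (w n))
        = - (?L (c n) - P) + - (scl (b n) (w n) - scl e (w n))"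
      by (simp add: algebra_simps)
    also have "infdist \<dots> Y \<le> (real m + 1) * \<eta> + \<eta>"
      using infdist_add_le[of "- (?L (c n) - P)" "- (scl (b n) (w n) - scl e (w n))"] L b
      unfolding infdist_minus by linarith
    finally have "infdist (P + scl e (w n)) Y \<le> infdist (?L (c n) + scl (b n) (w n)) Y + \<delta> / 4"
      using \<eta>(2) by (simp add: algebra_simps)
    moreover have "infdist (?L (c n)) Y \<le> infdist P Y + \<delta> / 4"
      using infdist_diff_le[of "?L (c n)" P] L \<eta> by (simp add: algebra_simps)
    ultimately show ?thesis
      using bad by auto
  qed
  obtain N :: nat where N: "norm e / (\<delta> / 2) < real N"
    using reals_Archimedean2 by blast
  then have N0: "0 < N" and Ne: "norm e < real N * (\<delta> / 2)"
  proof -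
    have "0 \<le> norm e / (\<delta> / 2)" using \<open>0 < \<delta>\<close> by simp
    then show "0 < N" using N by (metis not_le of_nat_0 of_nat_0_less_iff order.strict_trans1)
    show "norm e < real N * (\<delta> / 2)" using N \<open>0 < \<delta>\<close> by (simp add: field_simps)
  qed
  obtain E where E: "E \<subseteq> {n \<in> B. code n = code n0}" "finite E" "card E = N" "infdist (\<Sum>n\<in>E. w n) Y \<le> 1"
    using sums[OF inf N0] by blast
  have "(\<Sum>n\<in>E. P) = (\<Sum>n\<in>E. scl 1 P)"
    by simp
  also have "\<dots> = scl (of_nat N) P"
    using E(3) by (simp flip: scale_sum_left del: scale_one)
  finally have "real N * infdist P Y = infdist (\<Sum>n\<in>E. P) Y"
    by (simp add: infdist_scl)
  also have "(\<Sum>n\<in>E. P) = (\<Sum>n\<in>E. P + scl e (w n)) + - scl e (\<Sum>n\<in>E. w n)"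
    by (simp add: sum.distrib scale_sum_right)
  also have "infdist \<dots> Y \<le> (\<Sum>n\<in>E. infdist (P + scl e (w n)) Y) + norm e * infdist (\<Sum>n\<in>E. w n) Y"
    using infdist_add_le[of "\<Sum>n\<in>E. P + scl e (w n)" "- scl e (\<Sum>n\<in>E. w n)"]
      infdist_sum_le[of "\<lambda>n. P + scl e (w n)" E]
    unfolding infdist_minus infdist_scl by linarith
  also have "\<dots> \<le> (\<Sum>n\<in>E. infdist P Y - \<delta> / 2) + norm e * 1"
    using E(1,4) dec by (intro add_mono sum_mono mult_left_mono) auto
  also have "\<dots> = real N * infdist P Y - real N * (\<delta> / 2) + norm e"
    using E(3) by (simp add: algebra_simps)
  finally show False
    using Ne by simp
qed

text \<open>
  In a subsequence chosen by the Mazur step every initial part of a combination is dominated by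
  the whole combination, up to \<open>\<delta>\<close>; each term is the difference of two initial parts.
\<close>

lemma basic_subsequence:
  fixes w :: "nat \<Rightarrow> 'a"
  assumes bound: "\<And>n. infdist (w n) Y \<le> 1"
    and sums: "\<And>B N. infinite B \<Longrightarrow> 0 < N \<Longrightarrow> \<exists>E\<subseteq>B. finite E \<and> card E = N \<and> infdist (\<Sum>n\<in>E. w n) Y \<le> 1"
    and "0 < \<delta>"
  shows "\<exists>g :: nat \<Rightarrow> nat. strict_mono g \<and> (\<forall>A c j. finite A \<longrightarrow> (\<forall>i. norm (c i) \<le> 1) \<longrightarrow> j \<in> A \<longrightarrow>
    norm (c j) * infdist (w (g j)) Y \<le> 2 * (infdist (\<Sum>i\<in>A. scl (c i) (w (g i))) Y + \<delta>))"
proof -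
  have "\<exists>N. \<forall>n>N. \<forall>c b. (\<forall>i. norm (c i) \<le> 1) \<longrightarrow> norm b \<le> 1 \<longrightarrow>
    infdist (\<Sum>i\<le>m. scl (c i) (w i)) Y
      \<le> infdist ((\<Sum>i\<le>m. scl (c i) (w i)) + scl b (w n)) Y + \<delta> * (1 / 2) ^ Suc (Suc m)" for m
    using \<open>0 < \<delta>\<close> by (intro mazur_step[OF bound sums]) auto
  then have "\<exists>N. \<forall>m. \<forall>n>N m. \<forall>c b. (\<forall>i. norm (c i) \<le> 1) \<longrightarrow> norm b \<le> 1 \<longrightarrow>
    infdist (\<Sum>i\<le>m. scl (c i) (w i)) Y
      \<le> infdist ((\<Sum>i\<le>m. scl (c i) (w i)) + scl b (w n)) Y + \<delta> * (1 / 2) ^ Suc (Suc m)"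
    by (intro choice allI)
  then obtain N where N: "\<And>m n c b. N m < n \<Longrightarrow> (\<forall>i. norm (c i) \<le> 1) \<Longrightarrow> norm b \<le> 1 \<Longrightarrow>
    infdist (\<Sum>i\<le>m. scl (c i) (w i)) Y
      \<le> infdist ((\<Sum>i\<le>m. scl (c i) (w i)) + scl b (w n)) Y + \<delta> * (1 / 2) ^ Suc (Suc m)"
    by blast
  have "\<exists>g :: nat \<Rightarrow> nat. \<forall>k. True \<and> (g k < g (Suc k) \<and> N (g k) < g (Suc k))"
  proof (rule dependent_nat_choice)
    show "\<exists>n'. True \<and> (n < n' \<and> N n < n')" for n
      by (intro exI[of _ "Suc (n + N n)"]) simp
  qed simp
  then obtain g :: "nat \<Rightarrow> nat" where g: "\<And>k. g k < g (Suc k)" "\<And>k. N (g k) < g (Suc k)"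
    by blast
  have sm: "strict_mono g"
    using g(1) by (simp add: strict_mono_Suc_iff)
  have inv: "inv g (g i) = i" for i
    using strict_mono_imp_inj_on[OF sm] by simp
  have "norm (c j) * infdist (w (g j)) Y \<le> 2 * (infdist (\<Sum>i\<in>A. scl (c i) (w (g i))) Y + \<delta>)"
    if A: "finite A" "\<forall>i. norm (c i) \<le> 1" "j \<in> A" for A c j
  proof -
    define d where "d = (\<lambda>i. if i \<in> A then c i else 0)"
    define P where "P = (\<lambda>k. \<Sum>i<k. scl (d i) (w (g i)))"
    have d: "norm (d i) \<le> 1" for i
      using A(2) by (simp add: d_def)
    have "infdist (P k) Y \<le> infdist (P (Suc k)) Y + \<delta> * (1 / 2) ^ Suc k" for k
    proof (cases k)
      case 0
      then show ?thesis
        using Y_zero \<open>0 < \<delta>\<close> infdist_nonneg[of "P 1" Y] by (simp add: P_def)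
    next
      case (Suc l)
      define d' where "d' = (\<lambda>i. if i \<in> g ` {..l} then d (inv g i) else 0)"
      have d': "norm (d' i) \<le> 1" for i
        using d by (simp add: d'_def)
      have sub: "g ` {..l} \<subseteq> {..g l}"
        using sm by (auto simp: strict_mono_less_eq)
      have "P k = (\<Sum>i\<in>{..l}. scl (d' (g i)) (w (g i)))"
        unfolding P_def Suc lessThan_Suc_atMost by (intro sum.cong) (auto simp: d'_def inv)
      also have "\<dots> = (\<Sum>i\<in>g ` {..l}. scl (d' i) (w i))"
        using strict_mono_imp_inj_on[OF sm] by (simp add: sum.reindex inj_on_subset)
      also have "\<dots> = (\<Sum>i\<le>g l. scl (d' i) (w i))"
        using sub by (intro sum.mono_neutral_left) (auto simp: d'_def)
      finally have P: "P k = (\<Sum>i\<le>g l. scl (d' i) (w i))" .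
      have "infdist (P k) Y \<le> infdist (P k + scl (d k) (w (g k))) Y + \<delta> * (1 / 2) ^ Suc (Suc (g l))"
        unfolding P using g(2)[of l] d' d by (intro N) (auto simp: Suc)
      also have "P k + scl (d k) (w (g k)) = P (Suc k)"
        by (simp add: P_def)
      also have "\<delta> * (1 / 2) ^ Suc (Suc (g l)) \<le> \<delta> * (1 / 2) ^ Suc k"
        using \<open>0 < \<delta>\<close> strict_mono_imp_increasing[OF sm, of l]
        by (intro mult_left_mono power_decreasing) (auto simp: Suc)
      finally show ?thesis by simp
    qed
    then have "infdist (P k) Y - \<delta> * (1 / 2) ^ k \<le> infdist (P (Suc k)) Y - \<delta> * (1 / 2) ^ Suc k" for k
      by (simp add: algebra_simps)
    then have mono: "incseq (\<lambda>k. infdist (P k) Y - \<delta> * (1 / 2) ^ k)"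
      by (rule incseq_SucI)
    obtain n where n: "A \<subseteq> {..<n}"
      using A(1) finite_nat_iff_bounded by blast
    have init: "infdist (P k) Y \<le> infdist (P n) Y + \<delta>" if "k \<le> n" for k
    proof -
      have "\<delta> * (1 / 2) ^ k \<le> \<delta> * 1" "0 \<le> \<delta> * (1 / 2) ^ n"
        using \<open>0 < \<delta>\<close> by (auto intro!: mult_left_mono power_le_one)
      then show ?thesis
        using incseqD[OF mono that] by simp
    qed
    have "j < n"
      using n A(3) by blast
    have "scl (c j) (w (g j)) = P (Suc j) + - P j"
      using A(3) by (simp add: P_def d_def)
    then have "norm (c j) * infdist (w (g j)) Y \<le> infdist (P (Suc j)) Y + infdist (P j) Y"
      using infdist_add_le[of "P (Suc j)" "- P j"] by (simp add: infdist_minus flip: infdist_scl)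
    also have "\<dots> \<le> 2 * (infdist (P n) Y + \<delta>)"
      using init[of j] init[of "Suc j"] \<open>j < n\<close> by simp
    also have "P n = (\<Sum>i\<in>A. scl (d i) (w (g i)))"
      unfolding P_def using n by (intro sum.mono_neutral_right) (auto simp: d_def)
    also have "\<dots> = (\<Sum>i\<in>A. scl (c i) (w (g i)))"
      by (intro sum.cong) (auto simp: d_def)
    finally show ?thesis .
  qed
  with sm show ?thesis by blast
qed

end


section \<open>Spreading models in quotients\<close>

context normed_subspace
begin

text \<open>
  The averages needed for the selection are sums over sets from \<open>S 1\<close>, which are almost contained in
  \<open>S \<xi>\<close> for \<open>\<xi> > 0\<close>.  For \<open>\<xi> = 0\<close> they are not available, but the sums over \<open>A\<close> consist of
  single vectors.
\<close>

lemma lower_c0_estimate_subsequence: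
  fixes w :: "nat \<Rightarrow> 'a" and S :: "'b ordinal \<Rightarrow> nat set set"
  assumes S: "schreier_families S" and \<xi>: "\<xi> \<le> omega1" and e: "0 < e"
    and w: "\<And>n. norm (w n) \<le> 1" "\<And>n. e \<le> infdist (w n) Y"
    and sums: "\<And>B N. 0 < \<xi> \<Longrightarrow> infinite B \<Longrightarrow> 0 < N \<Longrightarrow>
      \<exists>E\<subseteq>B. finite E \<and> card E = N \<and> norm (\<Sum>n\<in>E. w n) \<le> 1"
  shows "\<exists>g :: nat \<Rightarrow> nat. strict_mono g \<and> (\<forall>A\<in>S \<xi>. \<forall>c. (\<forall>i. norm (c i) \<le> 1) \<longrightarrow>
    (\<forall>j\<in>A. norm (c j) = 1 \<longrightarrow> e / 4 \<le> infdist (\<Sum>i\<in>A. scl (c i) (w (g i))) Y))"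
proof (cases "\<xi> = 0")
  case True
  have "e / 4 \<le> infdist (\<Sum>i\<in>A. scl (c i) (w (id i))) Y"
    if "A \<in> S \<xi>" "j \<in> A" "norm (c j) = 1" for A c j
  proof -
    have "finite A" "card A \<le> 1"
      using that(1) by (auto simp: True schreier_zero[OF S])
    then have "A = {j}"
      using that(2) by (auto simp: card_le_Suc0_iff_eq)
    then have "infdist (\<Sum>i\<in>A. scl (c i) (w (id i))) Y = infdist (w j) Y"
      using that(3) by (simp add: infdist_scl)
    then show ?thesis
      using w(2)[of j] e by simp
  qed
  then show ?thesis
    using strict_mono_id by blast
next
  case False
  then have pos: "0 < \<xi>"
    using zero_le_ordinal[of \<xi>] by (simp add: order.strict_iff_order)
  have bound: "infdist (w n) Y \<le> 1" for n
    using infdist_le_norm w(1) by (rule order.trans)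
  have avg: "\<exists>E\<subseteq>B. finite E \<and> card E = N \<and> infdist (\<Sum>n\<in>E. w n) Y \<le> 1"
    if "infinite B" "0 < N" for B N
    using sums[OF pos that] infdist_le_norm order.trans by blast
  have e4: "0 < e / 4"
    using e by simp
  have "\<exists>g :: nat \<Rightarrow> nat. strict_mono g \<and> (\<forall>A c j. finite A \<longrightarrow> (\<forall>i. norm (c i) \<le> 1) \<longrightarrow> j \<in> A \<longrightarrow>
    norm (c j) * infdist (w (g j)) Y \<le> 2 * (infdist (\<Sum>i\<in>A. scl (c i) (w (g i))) Y + e / 4))"
    using bound avg e4 by (rule basic_subsequence)
  then obtain g :: "nat \<Rightarrow> nat" where g: "strict_mono g"
    "\<forall>A c j. finite A \<longrightarrow> (\<forall>i. norm (c i) \<le> 1) \<longrightarrow> j \<in> A \<longrightarrow>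
      norm (c j) * infdist (w (g j)) Y \<le> 2 * (infdist (\<Sum>i\<in>A. scl (c i) (w (g i))) Y + e / 4)"
    by (elim exE conjE)
  have "e / 4 \<le> infdist (\<Sum>i\<in>A. scl (c i) (w (g i))) Y"
    if "A \<in> S \<xi>" "\<forall>i. norm (c i) \<le> 1" "j \<in> A" "norm (c j) = 1" for A c j
  proof -
    have "finite A"
      using schreier_finite[OF S \<xi> that(1)] by blast
    then have "norm (c j) * infdist (w (g j)) Y \<le> 2 * (infdist (\<Sum>i\<in>A. scl (c i) (w (g i))) Y + e / 4)"
      using g(2) that by blast
    then show ?thesis
      using that(4) w(2)[of "g j"] by simp
  qed
  with g(1) show ?thesis by blast
qed

text \<open>
  The images under the quotient map inherit the upper \<open>c\<^sub>0\<close> estimates, and if they stay away from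
  \<open>0\<close>, a subsequence also has lower ones.
\<close>

lemma spreading_model_quotient:
  assumes S: "schreier_families S" and \<xi>: "\<xi> \<le> omega1" and e: "0 < e"
    and x: "spreading_model S \<infinity> (subspace_of scl UNIV) K \<xi> x"
    and far: "\<And>n. N < n \<Longrightarrow> e \<le> infdist (x n) Y"
  shows "\<exists>C\<ge>1. \<exists>v. spreading_model S \<infinity> (quotient_by scl Y) C \<xi> v"
proof -
  have T: "map x (sorted_list_of_set E) \<in> T_tree \<infinity> (subspace_of scl UNIV) K" if "E \<in> S \<xi>" for E
    using x that unfolding spreading_model_def by blast
  have p: "(1 :: ennreal) \<le> \<infinity>" by simp
  have lin_le: "norm (lin as (map x (sorted_list_of_set E))) \<le> 1"
    if "E \<in> S \<xi>" "length as = card E" "lp_norm \<infinity> as = 1" for E as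
    using T[OF that(1)] that(2,3) unfolding T_tree_subspace_iff[OF p] by simp
  obtain k where k: "k \<ge> 1"
    "0 < \<xi> \<Longrightarrow> \<forall>F. finite F \<longrightarrow> (\<forall>n\<in>F. k \<le> n \<and> card F \<le> n) \<longrightarrow> F \<in> S \<xi>"
    using schreier_one_subset[OF S _ \<xi>] by (cases "0 < \<xi>") blast+
  define l where "l = N + k"
  define w where "w = (\<lambda>n. x (n + l))"
  have l: "1 \<le> l" "N < n + l" "k \<le> n + l" for n
    using k(1) by (auto simp: l_def)
  have shift: "strict_mono (\<lambda>n. g n + l)" if "strict_mono g" for g :: "nat \<Rightarrow> nat"
    using that by (simp add: strict_mono_def)
  have map_w: "map x (sorted_list_of_set ((\<lambda>n. g n + l) ` E)) = map (\<lambda>n. w (g n)) (sorted_list_of_set E)"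
    if "strict_mono g" "finite E" for g :: "nat \<Rightarrow> nat" and E
    by (simp add: sorted_list_of_set_image[OF shift[OF that(1)] that(2)] w_def o_def)
  have w1: "norm (w n) \<le> 1" for n
  proof -
    have "{n + l} \<in> S \<xi>"
      using l(1) by (intro schreier_singleton[OF S \<xi>]) simp
    moreover have "lp_norm \<infinity> [1 :: 'k] = 1"
      unfolding lp_norm_infinity_eq_1_iff by simp
    ultimately show ?thesis
      using lin_le[of "{n + l}" "[1]"] by (simp add: w_def)
  qed
  have w2: "e \<le> infdist (w n) Y" for n
    unfolding w_def using l(2) by (rule far)
  have sums: "\<exists>E\<subseteq>B. finite E \<and> card E = M \<and> norm (\<Sum>n\<in>E. w n) \<le> 1"
    if "0 < \<xi>" and B: "infinite B" and M: "0 < M" for B M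
  proof -
    have "infinite (B - {..<M})"
      using B by simp
    then obtain E where E: "finite E" "card E = M" "E \<subseteq> B - {..<M}"
      using infinite_arbitrarily_large by blast
    let ?F = "(\<lambda>n. id n + l) ` E"
    have cardF: "card ?F = M"
      using E(2) by (simp add: card_image)
    have "M \<le> n" if "n \<in> E" for n
      using E(3) that by auto
    then have "\<forall>n\<in>?F. k \<le> n \<and> card ?F \<le> n"
      unfolding cardF using l(3) by (simp add: trans_le_add1)
    then have F: "?F \<in> S \<xi>"
      using k(2)[OF \<open>0 < \<xi>\<close>] E(1) by blast
    have "E \<noteq> {}"
      using E(2) M by auto
    then have "lp_norm \<infinity> (map (\<lambda>_. 1 :: 'k) (sorted_list_of_set E)) = 1"
      unfolding lp_norm_infinity_eq_1_iff using E(1) by auto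
    then have "norm (lin (map (\<lambda>_. 1) (sorted_list_of_set E)) (map (\<lambda>n. w (id n)) (sorted_list_of_set E))) \<le> 1"
      using lin_le[OF F] cardF E(2) unfolding map_w[OF strict_mono_id E(1)] by simp
    then have "norm (\<Sum>n\<in>E. w n) \<le> 1"
      using E(1) by (simp add: lin_map_sum)
    with E show ?thesis by blast
  qed
  obtain g :: "nat \<Rightarrow> nat" where g: "strict_mono g" "\<And>A c j. A \<in> S \<xi> \<Longrightarrow> (\<forall>i. norm (c i) \<le> 1) \<Longrightarrow> j \<in> A \<Longrightarrow>
      norm (c j) = 1 \<Longrightarrow> e / 4 \<le> infdist (\<Sum>i\<in>A. scl (c i) (w (g i))) Y"
    using lower_c0_estimate_subsequence[OF S \<xi> e w1 w2 sums] by blast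
  define C where "C = max 1 (4 / e)"
  have C: "1 \<le> C" "1 / C \<le> e / 4"
    using e by (auto simp: C_def field_simps max_def)
  have "map (\<lambda>n. coset (w (g n))) (sorted_list_of_set A) \<in> T_tree \<infinity> (quotient_by scl Y) C"
    if A: "A \<in> S \<xi>" for A
  proof -
    let ?js = "sorted_list_of_set A"
    let ?F = "(\<lambda>n. g n + l) ` A"
    have fin: "finite A"
      using schreier_finite[OF S \<xi> A] by blast
    have F: "?F \<in> S \<xi>"
      using S \<xi> A
    proof (rule schreier_spread)
      show "strict_mono_on A (\<lambda>n. g n + l)"
        using shift[OF g(1)] by (simp add: strict_mono_on_def strict_mono_def)
      show "n \<le> g n + l" for n
        using strict_mono_imp_increasing[OF g(1), of n] by simp
    qed
    have card: "card ?F = card A"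
      using strict_mono_imp_inj_on[OF shift[OF g(1)]] by (intro card_image) (rule inj_on_subset, auto)
    have "1 / C \<le> infdist (lin as (map (\<lambda>n. w (g n)) ?js)) Y \<and> infdist (lin as (map (\<lambda>n. w (g n)) ?js)) Y \<le> 1"
      if as: "length as = length ?js" "lp_norm \<infinity> as = 1" for as
    proof
      have "norm (lin as (map (\<lambda>n. w (g n)) ?js)) \<le> 1"
        using lin_le[OF F, of as] as card unfolding map_w[OF g(1) fin] by simp
      then show "infdist (lin as (map (\<lambda>n. w (g n)) ?js)) Y \<le> 1"
        using infdist_le_norm order.trans by blast
      obtain c where c: "as = map c ?js" "\<And>j. c j = 0 \<or> c j \<in> set as"
        using list_eq_map_on_distinct[of ?js as] as(1) by auto
      have as': "\<forall>a\<in>set as. norm a \<le> 1" "\<exists>a\<in>set as. norm a = 1"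
        using as(2) unfolding lp_norm_infinity_eq_1_iff by auto
      have "norm (c j) \<le> 1" for j
        using c(2)[of j] as'(1) by auto
      moreover obtain j where "j \<in> A" "norm (c j) = 1"
        using as'(2) fin unfolding c(1) by auto
      ultimately have "e / 4 \<le> infdist (\<Sum>i\<in>A. scl (c i) (w (g i))) Y"
        using g(2)[OF A] by blast
      also have "(\<Sum>i\<in>A. scl (c i) (w (g i))) = lin as (map (\<lambda>n. w (g n)) ?js)"
        unfolding c(1) using fin by (simp add: lin_map_sum)
      finally show "1 / C \<le> infdist (lin as (map (\<lambda>n. w (g n)) ?js)) Y"
        using C(2) by simp
    qed
    moreover have "infdist (w n) Y \<le> 1" for n
      using infdist_le_norm w1 by (rule order.trans)
    ultimately have "map coset (map (\<lambda>n. w (g n)) ?js) \<in> T_tree \<infinity> (quotient_by scl Y) C"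
      unfolding T_tree_quotient_iff by simp
    then show ?thesis
      by (simp add: o_def)
  qed
  then have "spreading_model S \<infinity> (quotient_by scl Y) C \<xi> (\<lambda>n. coset (w (g n)))"
    unfolding spreading_model_def by (auto simp: quotient_by_def coset_def)
  with C(1) show ?thesis by blast
qed

text \<open>
  If the distances of \<open>x\<^sub>n\<close> to \<open>Y\<close> have \<open>0\<close> as a cluster point, blocks are single vectors: the
  block families are then \<open>S \<theta>\<close> on both sides, and no sum of ordinals appears.
\<close>

lemma SM_index_infinity_le_max:
  assumes S: "schreier_families S"
  shows "SM_index S \<infinity> (subspace_of scl UNIV)
    \<le> max (SM_index S \<infinity> (quotient_by scl Y)) (SM_index S \<infinity> (subspace_of scl Y))"
    (is "_ \<le> ?m")
proof (cases ?m)
  case Infty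
  then show ?thesis by simp
next
  case (Ord \<xi>)
  have sub: "SM_index_const S \<infinity> (quotient_by scl Y) C \<le> Ord \<xi>"
    "SM_index_const S \<infinity> (subspace_of scl Y) C \<le> Ord \<xi>" if "1 \<le> C" for C
    using that unfolding Ord[symmetric] SM_index_def
    by (auto intro: SUP_upper max.coboundedI1 max.coboundedI2)
  have "SM_index_const S \<infinity> (subspace_of scl UNIV) K \<le> Ord \<xi>" if K: "1 \<le> K" for K
  proof (rule ccontr)
    assume not_le: "\<not> ?thesis"
    define \<theta> where "\<theta> = min \<xi> omega1"
    have \<theta>: "\<theta> \<le> omega1" "\<xi> \<le> \<theta> \<or> \<theta> = omega1" "\<theta> \<le> \<xi>"
      by (auto simp: \<theta>_def min_def)
    then obtain x where x: "spreading_model S \<infinity> (subspace_of scl UNIV) K \<theta> x"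
      using not_le unfolding SM_index_const_le_iff by blast
    show False
    proof (cases "\<exists>e>0. \<exists>N. \<forall>n>N. e \<le> infdist (x n) Y")
      case True
      then obtain C v where "1 \<le> C" "spreading_model S \<infinity> (quotient_by scl Y) C \<theta> v"
        using spreading_model_quotient[OF S \<theta>(1) _ x] by metis
      then show False
        using no_spreading_model[OF S sub(1) \<theta>(1,2)] by blast
    next
      case False
      have p: "(1 :: ennreal) \<le> \<infinity>" by simp
      obtain \<delta> where \<delta>: "0 < \<delta>" "\<delta> \<le> 1" "(1 + \<delta>) / (2 * K) \<le> 1 / K - \<delta>"
        using perturbation_constant[of K "2 * K"] K by auto
      have "\<exists>E\<in>{{n} | n. 1 \<le> n}. (\<forall>n\<in>E. N < n) \<and> (\<exists>as. length as = card E \<and> lp_norm \<infinity> as = 1 \<and>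
          infdist (lin as (map x (sorted_list_of_set E))) Y < \<delta> * (1 / 2) ^ Suc k)" for k N
      proof -
        have "0 < \<delta> * (1 / 2) ^ Suc k"
          using \<delta>(1) by simp
        then obtain n where "N < n" "infdist (x n) Y < \<delta> * (1 / 2) ^ Suc k"
          using False by (meson linorder_not_le)
        moreover have "lp_norm \<infinity> [1 :: 'k] = 1"
          unfolding lp_norm_infinity_eq_1_iff by simp
        ultimately show ?thesis
          by (intro bexI[of _ "{n}"] conjI exI[of _ "[1]"]) auto
      qed
      moreover have "(\<Union>i\<in>A. E i) \<in> S \<theta>" if A: "A \<in> S \<theta>" "successive_blocks {{n} | n. 1 \<le> n} A E" for A E
      proof -
        have E: "E i = {the_elem (E i)}" if i: "i \<in> A" for i
        proof -
          obtain n where "E i = {n}"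
            using A(2) i unfolding successive_blocks_def by blast
          then show ?thesis by simp
        qed
        have "(\<lambda>i. the_elem (E i)) ` A \<in> S \<theta>"
          using S \<theta>(1) A(1)
        proof (rule schreier_spread)
          show "strict_mono_on A (\<lambda>i. the_elem (E i))"
            using A(2) E unfolding successive_blocks_def strict_mono_on_def by (metis insertI1)
          show "i \<le> the_elem (E i)" if "i \<in> A" for i
            using A(2) E[OF that] that unfolding successive_blocks_def by (metis insertI1)
        qed
        moreover have "(\<Union>i\<in>A. E i) = (\<lambda>i. the_elem (E i)) ` A"
          using E by auto
        ultimately show ?thesis by simp
      qed
      moreover have "map x (sorted_list_of_set E) \<in> T_tree \<infinity> (subspace_of scl UNIV) K" if "E \<in> S \<theta>" for E
        using x that unfolding spreading_model_def by blast
      ultimately obtain y where "\<forall>n. y n \<in> Y"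
        "\<forall>A\<in>S \<theta>. map y (sorted_list_of_set A) \<in> T_tree \<infinity> (subspace_of scl Y) (2 * K)"
        using block_sequence[OF p dual_bound_geometric[OF p, of \<delta>] _ \<delta>(3), of "S \<theta>" x "S \<theta>" "{{n} | n. 1 \<le> n}"]
          schreier_finite[OF S \<theta>(1)] \<delta>(1) by auto
      then have "spreading_model S \<infinity> (subspace_of scl Y) (2 * K) \<theta> y"
        unfolding spreading_model_def by simp
      then show False
        using no_spreading_model[OF S sub(2) \<theta>(1,2)] K by auto
    qed
  qed
  then show ?thesis
    unfolding Ord unfolding SM_index_def by (auto intro: SUP_least)
qed

end


section \<open>Indices of a space, a subspace and the quotient\<close>

theorem theorem8p1:
  fixes scl :: "'k::{real_normed_field, euclidean_space} \<Rightarrow> 'a::banach \<Rightarrow> 'a"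
    and Y :: "'a set"
    and S :: "'a ordinal \<Rightarrow> nat set set"
    and p :: ennreal
    and K C :: real
  assumes "scalar_mult scl"
    and "closed Y"
    and "module.subspace scl Y"
    and "schreier_families S"
    and "1 \<le> p"
    and "1 \<le> K"
    and "K < C"
  shows "((I_index_const p (subspace_of scl UNIV) K :: 'a ordinal_inf)
           \<le> I_index p (quotient_by scl Y) * I_index_const p (subspace_of scl Y) C) \<and>
     ((I_index_const 1 (subspace_of scl UNIV) K :: 'a ordinal_inf)
           \<le> I_index_const 1 (quotient_by scl Y) (3 * K) * I_index_const 1 (subspace_of scl Y) (3 * K)) \<and>
     (SM_index_const S p (subspace_of scl UNIV) K
           \<le> SM_index S p (quotient_by scl Y) + SM_index_const S p (subspace_of scl Y) C) \<and>
     (SM_index_const S 1 (subspace_of scl UNIV) K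
           \<le> SM_index_const S 1 (quotient_by scl Y) (3 * K) + SM_index_const S 1 (subspace_of scl Y) (3 * K)) \<and>
     (SM_index S \<infinity> (subspace_of scl UNIV)
           \<le> max (SM_index S \<infinity> (quotient_by scl Y)) (SM_index S \<infinity> (subspace_of scl Y)))"
proof -
  interpret normed_subspace scl Y
    using assms(1,3) by (rule normed_subspace.intro)
  note S = assms(4) and p = assms(5)
  obtain \<delta> where \<delta>: "0 < \<delta>" "\<delta> \<le> 1" "(1 + \<delta>) / C \<le> 1 / K - \<delta>"
    using perturbation_constant[OF assms(6,7)] .
  define \<epsilon> where "\<epsilon> = (\<lambda>k :: nat. \<delta> * (1 / 2) ^ Suc k)"
  have \<epsilon>: "dual_bound p \<epsilon> \<delta>"
    unfolding \<epsilon>_def using p \<delta>(1) by (intro dual_bound_geometric) auto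
  have ge_1: "1 / \<epsilon> k \<in> {1..}" for k
  proof -
    have "\<epsilon> k \<le> 1 * 1"
      unfolding \<epsilon>_def using \<delta>(1,2) power_le_one[of "1 / 2 :: real" "Suc k"] by (intro mult_mono) auto
    moreover have "0 < \<epsilon> k"
      using \<delta>(1) by (simp add: \<epsilon>_def)
    ultimately show ?thesis by simp
  qed
  \<comment> \<open>For \<open>p = 1\<close> constant errors \<open>1 / (3 K)\<close> are admissible, and they turn the constant \<open>K\<close> into
    \<open>(1 + 1 / (3 K)) / (2 / (3 K)) \<le> 3 K\<close>.\<close>
  define \<delta>' where "\<delta>' = 1 / (3 * K)"
  have \<delta>': "0 \<le> \<delta>'" "(1 + \<delta>') / (3 * K) \<le> 1 / K - \<delta>'" "1 / \<delta>' = 3 * K"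
    using assms(6) by (auto simp: \<delta>'_def field_simps)
  note \<epsilon>' = dual_bound_one[of \<delta>']
  have one: "(1 :: ennreal) \<le> 1" by simp
  have "I_index_const p (subspace_of scl UNIV) K
      \<le> I_index p (quotient_by scl Y) * (I_index_const p (subspace_of scl Y) C :: 'a ordinal_inf)"
  proof (rule le_mult_ordinal_inf)
    fix \<alpha> \<beta> :: "'a ordinal"
    assume "I_index p (quotient_by scl Y) = Ord \<alpha>" "I_index_const p (subspace_of scl Y) C = Ord \<beta>"
    then show "I_index_const p (subspace_of scl UNIV) K \<le> Ord (\<alpha> * \<beta>)"
      using SUP_upper[OF ge_1, of "I_index_const p (quotient_by scl Y) :: real \<Rightarrow> 'a ordinal_inf"] \<delta>
      by (intro I_index_const_le_mult[OF p \<epsilon>]) (auto simp: I_index_def)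
  qed
  moreover have "I_index_const 1 (subspace_of scl UNIV) K \<le> I_index_const 1 (quotient_by scl Y) (3 * K)
      * (I_index_const 1 (subspace_of scl Y) (3 * K) :: 'a ordinal_inf)"
    using \<delta>' by (intro le_mult_ordinal_inf I_index_const_le_mult[OF one \<epsilon>']) auto
  moreover have "SM_index_const S p (subspace_of scl UNIV) K
      \<le> SM_index S p (quotient_by scl Y) + SM_index_const S p (subspace_of scl Y) C"
  proof (rule le_plus_ordinal_inf)
    fix \<xi> \<zeta> :: "'a ordinal"
    assume "SM_index S p (quotient_by scl Y) = Ord \<xi>" "SM_index_const S p (subspace_of scl Y) C = Ord \<zeta>"
    then show "SM_index_const S p (subspace_of scl UNIV) K \<le> Ord (\<xi> + \<zeta>)"
      using SUP_upper[OF ge_1, of "SM_index_const S p (quotient_by scl Y)"] \<delta>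
      by (intro SM_index_const_le_plus[OF S p \<epsilon>]) (auto simp: SM_index_def)
  qed
  moreover have "SM_index_const S 1 (subspace_of scl UNIV) K
      \<le> SM_index_const S 1 (quotient_by scl Y) (3 * K) + SM_index_const S 1 (subspace_of scl Y) (3 * K)"
    using \<delta>' by (intro le_plus_ordinal_inf SM_index_const_le_plus[OF S one \<epsilon>']) auto
  moreover note SM_index_infinity_le_max[OF S]
  ultimately show ?thesis
    by blast
qed

end
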